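(* Let $\theta:\mathbb{R}\to\mathbb{R}$ be such that both functions $f=|\theta|$ and $f=|\theta\circ(-\mathrm{Id})|$ satisfy the basic conditions (B1)--(B5) listed in the context. Let $A=\{(t,\theta(t)) : t\in\mathbb{R}\}\subset\mathbb{R}^2$, $B=\mathbb{R}\times\{0\}$, and, for a starting point $\mathbf{x}_0=(x_0,0)$, let $\mathbf{x}_{n+1}=C_T\mathbf{x}_n$ ($n\ge 0$). Then the following hold. (I) Suppose that $f=|\theta|$ and $f=|\theta\circ(-\mathrm{Id})|$ both satisfy case (i)$^\dagger$. Let $K'>1$ and $$\epsilon=\min\{\epsilon_{|\theta|},\ \epsilon_{|\theta\circ(-\mathrm{Id})|},\ \epsilon_{K'_{|\theta|}},\ \epsilon_{K'_{|\theta\circ(-\mathrm{Id})|}}\},$$ and let $x_0\in[-\epsilon,\epsilon]$. Then $\mathbf{x}_n\to\mathbf{0}$ as $n\to\infty$ with convergence rate that is never worse than $1/K'$ and ultimately either finite or quadratic. (II) Suppose that $f=|\theta|$ and $f=|\theta\circ(-\mathrm{Id})|$ both satisfy case (ii)$^\dagger$. Let $K'>1$, let $\epsilon=\min\{\epsilon_{|\theta|}, \epsilon_{|\theta\circ(-\mathrm{Id})|}, \epsilon_{K'_{|\theta|}}, \epsilon_{K'_{|\theta\circ(-\mathrm{Id})|}}\}$, and let $x_0\in[-\epsilon,\epsilon]$. Then $\mathbf{x}_n\to\mathbf{0}$ as $n\to\infty$ with convergence rate that is never worse than $1/K'$ and ultimately either finite or superlinear. (III) If $f=|\theta|$ satisfies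 case (iii)$^\dagger$ and $x_0\in[0,\min\{\epsilon_{|\theta|},\delta_{\rm RIGHT}\}]$, then $\mathbf{x}_n\to\mathbf{0}$ as $n\to\infty$ with convergence rate that is ultimately either finite or quadratic. (IV) If $f=|\theta|$ satisfies case (iv)$^\dagger$ and $x_0\in[0,\min\{\epsilon_{|\theta|},\delta_{\rm LIN}\}]$, then $\mathbf{x}_n\to\mathbf{0}$ as $n\to\infty$ with convergence rate that is ultimately either finite or linear.
   Context: Operators. For $S\subset\mathbb{R}^2$, $P_S\mathbf{x}$ denotes a (selected) nearest point of $S$ to $\mathbf{x}$, i.e. $P_S$ is a fixed selector of the set-valued map $\mathbb{P}_S\mathbf{x}=\{\mathbf{z}\in S:\|\mathbf{x}-\mathbf{z}\|=\inf_{\mathbf{v}\in S}\|\mathbf{x}-\mathbf{v}\|\}$; $R_S=2P_S-\mathrm{Id}$; $T_{A,B}=\frac12R_BR_A+\frac12\mathrm{Id}$. The circumcenter $C(\mathbf{u},\mathbf{v},\mathbf{w})$ is the point of the affine hull of $\{\mathbf{u},\mathbf{v},\mathbf{w}\}$ equidistant from $\mathbf{u},\mathbf{v},\mathbf{w}$, and $\mathrm{CRM}(\mathbf{x})=C(\mathbf{x},R_A\mathbf{x},R_BR_A\mathbf{x})$. Three points are colinear if they lie on a common line (in particular if two of them coincide). $C_T\mathbf{x}=T_{A,B}\mathbf{x}$ if $\mathbf{x},R_A\mathbf{x},R_BR_A\mathbf{x}$ are colinear, and $C_T\mathbf{x}=\mathrm{CRM}(\mathbf{x})$ otherwise. Basic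 conditions on $f:\mathbb{R}\to\mathbb{R}$: (B1) $f$ is continuous and $\mathbf{0}=(0,0)$ is an isolated point of $\{(t,f(t)):t\in\mathbb{R}\}\cap(\mathbb{R}\times\{0\})$ (in particular $f(0)=0$); (B2) there is $\epsilon_1>0$ such that $0$ is the only root of $f$ on $[-\epsilon_1,\epsilon_1]$; (B3) $f$ is continuous on $[-\epsilon_1,\epsilon_1]$ and differentiable on $[-\epsilon_1,\epsilon_1]\setminus\{0\}$; (B4) there is $\epsilon_2>0$ such that $f$ is differentiable with $f'(t)\ne0$ for all $t\in[-\epsilon_2,\epsilon_2]\setminus\{0\}$; (B5) there is $\epsilon_3>0$ such that $f'$ is continuous and differentiable on $[-\epsilon_3,\epsilon_3]\setminus\{0\}$ with $f''(t)\neq0$ there. For such an $f$ (with fixed choices of $\epsilon_1,\epsilon_2,\epsilon_3$), $\epsilon_f:=\min\{\epsilon_1,\epsilon_2/2,\epsilon_3\}$. Cases (at $t=0$, $f'(0)$ and $f''(0)$ denote right-sided derivatives): (i)$^\dagger$ $f''(t)<0$ for $t\in[0,\epsilon_f]$, and $f$ is right differentiable at $0$ with $\lim_{t\downarrow0}f'(t)\in(0,\infty)$. (ii)$^\dagger$ $f''(t)<0$ for $t\in(0,\epsilon_f]$, and $\lim_{t\downarrow0}f'(t)=\infty$. (iii)$^\dagger$ $f''(t)>0$ for $t\in[0,\epsilon_f]$, and $f'(0)\neq0$. (iv)$^\dagger$ $f''(t)>0$ for $t\in(0,\epsilon_f]$, $f'(0)=0$, and there exists $h\in C^m[-\epsilon_f,\epsilon_f]$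 such that $h(t)=f(t)$ for $t\in(0,\epsilon_f]$ and $0$ is a root of $h$ of multiplicity $m$ (i.e. $h^{(j)}(0)=0$ for $0\le j<m$, $h^{(m)}(0)\ne0$). Constants. For $f$ satisfying (B1)--(B5), nonnegative, with $f''<0$ on $(0,\epsilon_3]$, and for $K>0$, $\epsilon_{K_f}>0$ denotes a constant such that, with $A$ replaced by the graph of $f$ and for every selection of nearest points, $\|C_T(x,0)\|\le\frac1K\|(x,0)\|$ for all $x\in(0,\epsilon_{K_f}]$ (such a constant exists). In (III), $\delta_{\rm RIGHT}>0$ is a constant for which there is $M_{\rm RIGHT}\in\mathbb{R}$ with $\left|t-\frac{f(t)}{f'(t)}\right|<\frac{M_{\rm RIGHT}}{2}t^2$ for all $t\in(0,\delta_{\rm RIGHT}]$, where $f=|\theta|$. In (IV), with $h,m$ as in (iv)$^\dagger$ for $f=|\theta|$ and $k=\frac12\left(\frac{m-1}{m}+1\right)<1$, $\delta_{\rm LIN}>0$ is a constant such that $\left|t-\frac{h(t)}{h'(t)}\right|<k|t|$ for all $0<|t|\le\delta_{\rm LIN}$. Rates. "Never worse than $1/K'$": $\|\mathbf{x}_{n+1}\|\le\frac1{K'}\|\mathbf{x}_n\|$ for all $n$. "Finite": $\mathbf{x}_n=\mathbf{0}$ for some $n$. When convergence is not finite: "quadratic" means $\|\mathbf{x}_{n+1}\|\le M\|\mathbf{x}_n\|^2$ for some constant $M$ and all large $n$; "superlinear" means $\|\mathbf{x}_{n+1}\|/\|\mathbf{x}_n\|\to0$; "linear" means $\|\mathbf{x}_{n+1}\|\le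 k\|\mathbf{x}_n\|$ for some $k<1$ and all large $n$. *)

theory Defs
  imports "HOL-Analysis.Analysis"
begin

section \<open>The operators\<close>

definition nearest :: "(real \<times> real) set \<Rightarrow> real \<times> real \<Rightarrow> (real \<times> real) set" where
  "nearest S x = {z \<in> S. norm (x - z) = (INF v\<in>S. norm (x - v))}"

text \<open>
  A selector is only constrained at points that have a nearest point. This matters because only
  \<open>\<bar>\<theta>\<bar>\<close> is assumed continuous below: the graph of \<open>\<theta>\<close> need not be closed, although every point
  of the horizontal axis has a nearest point in it.
\<close>

definition selector :: "(real \<times> real \<Rightarrow> real \<times> real) \<Rightarrow> (real \<times> real) set \<Rightarrow> bool" where
  "selector P S \<longleftrightarrow> (\<forall>x. nearest S x \<noteq> {} \<longrightarrow> P x \<in> nearest S x)"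

definition refl_op :: "(real \<times> real \<Rightarrow> real \<times> real) \<Rightarrow> real \<times> real \<Rightarrow> real \<times> real" where
  "refl_op P x = 2 *\<^sub>R P x - x"

definition DR_op ::
  "(real \<times> real \<Rightarrow> real \<times> real) \<Rightarrow> (real \<times> real \<Rightarrow> real \<times> real) \<Rightarrow> real \<times> real \<Rightarrow> real \<times> real" where
  "DR_op PA PB x = (1/2) *\<^sub>R refl_op PB (refl_op PA x) + (1/2) *\<^sub>R x"

definition circumcenter :: "real \<times> real \<Rightarrow> real \<times> real \<Rightarrow> real \<times> real \<Rightarrow> real \<times> real" where
  "circumcenter u v w =
     (THE c. c \<in> affine hull {u, v, w} \<and> dist c u = dist c v \<and> dist c v = dist c w)"

definition CRM ::
  "(real \<times> real \<Rightarrow> real \<times> real) \<Rightarrow> (real \<times> real \<Rightarrow> real \<times> real) \<Rightarrow> real \<times> real \<Rightarrow> real \<times> real" where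
  "CRM PA PB x = circumcenter x (refl_op PA x) (refl_op PB (refl_op PA x))"

definition C_T ::
  "(real \<times> real \<Rightarrow> real \<times> real) \<Rightarrow> (real \<times> real \<Rightarrow> real \<times> real) \<Rightarrow> real \<times> real \<Rightarrow> real \<times> real" where
  "C_T PA PB x =
     (if collinear {x, refl_op PA x, refl_op PB (refl_op PA x)} then DR_op PA PB x
      else CRM PA PB x)"

definition iterates ::
  "(real \<times> real \<Rightarrow> real \<times> real) \<Rightarrow> (real \<times> real \<Rightarrow> real \<times> real) \<Rightarrow> real \<Rightarrow> nat \<Rightarrow> real \<times> real" where
  "iterates PA PB x0 n = (C_T PA PB ^^ n) (x0, 0)"

definition graph_of :: "(real \<Rightarrow> real) \<Rightarrow> (real \<times> real) set" where
  "graph_of f = range (\<lambda>t. (t, f t))"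

definition axis_B :: "(real \<times> real) set" where
  "axis_B = UNIV \<times> {0}"


section \<open>The basic conditions\<close>

text \<open>
  Derivatives on a set are taken relative to that set. They are the ordinary derivatives at its
  interior points and one-sided at an end point of an interval; in particular a derivative at
  \<open>0\<close> relative to \<open>[0, \<epsilon>]\<close> is a right-sided one. All the sets used have no isolated points, so
  these derivatives are unique.
\<close>

definition twice_deriv_on ::
  "(real \<Rightarrow> real) \<Rightarrow> real set \<Rightarrow> (real \<Rightarrow> real) \<Rightarrow> (real \<Rightarrow> real) \<Rightarrow> bool" where
  "twice_deriv_on f S f' f'' \<longleftrightarrow>
     (\<forall>t\<in>S. (f has_real_derivative f' t) (at t within S) \<and>
            (f' has_real_derivative f'' t) (at t within S))"

definition B1 :: "(real \<Rightarrow> real) \<Rightarrow> bool" where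
  "B1 f \<longleftrightarrow> continuous_on UNIV f \<and> (0, 0) isolated_in (graph_of f \<inter> axis_B)"

definition B2 :: "(real \<Rightarrow> real) \<Rightarrow> real \<Rightarrow> bool" where
  "B2 f \<epsilon>1 \<longleftrightarrow> \<epsilon>1 > 0 \<and> (\<forall>t\<in>{-\<epsilon>1..\<epsilon>1}. f t = 0 \<longleftrightarrow> t = 0)"

definition B3 :: "(real \<Rightarrow> real) \<Rightarrow> real \<Rightarrow> bool" where
  "B3 f \<epsilon>1 \<longleftrightarrow> continuous_on {-\<epsilon>1..\<epsilon>1} f \<and> f differentiable_on ({-\<epsilon>1..\<epsilon>1} - {0})"

definition B4 :: "(real \<Rightarrow> real) \<Rightarrow> real \<Rightarrow> bool" where
  "B4 f \<epsilon>2 \<longleftrightarrow> \<epsilon>2 > 0 \<and>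
     (\<forall>t\<in>{-\<epsilon>2..\<epsilon>2} - {0}. \<exists>D. (f has_real_derivative D) (at t within ({-\<epsilon>2..\<epsilon>2} - {0})) \<and> D \<noteq> 0)"

definition B5 :: "(real \<Rightarrow> real) \<Rightarrow> real \<Rightarrow> bool" where
  "B5 f \<epsilon>3 \<longleftrightarrow> \<epsilon>3 > 0 \<and>
     (\<exists>f' f''. twice_deriv_on f ({-\<epsilon>3..\<epsilon>3} - {0}) f' f'' \<and>
        continuous_on ({-\<epsilon>3..\<epsilon>3} - {0}) f' \<and> (\<forall>t\<in>{-\<epsilon>3..\<epsilon>3} - {0}. f'' t \<noteq> 0))"

definition basic_conditions :: "(real \<Rightarrow> real) \<Rightarrow> real \<Rightarrow> real \<Rightarrow> real \<Rightarrow> bool" where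
  "basic_conditions f \<epsilon>1 \<epsilon>2 \<epsilon>3 \<longleftrightarrow> B1 f \<and> B2 f \<epsilon>1 \<and> B3 f \<epsilon>1 \<and> B4 f \<epsilon>2 \<and> B5 f \<epsilon>3"

definition eps_of :: "real \<Rightarrow> real \<Rightarrow> real \<Rightarrow> real" where
  "eps_of \<epsilon>1 \<epsilon>2 \<epsilon>3 = Min {\<epsilon>1, \<epsilon>2 / 2, \<epsilon>3}"


section \<open>The four cases\<close>

definition case_i :: "(real \<Rightarrow> real) \<Rightarrow> real \<Rightarrow> bool" where
  "case_i f \<epsilon> \<longleftrightarrow>
     (\<exists>f' f''. twice_deriv_on f {0..\<epsilon>} f' f'' \<and> (\<forall>t\<in>{0..\<epsilon>}. f'' t < 0) \<and>
        (\<exists>L>0. (f' \<longlongrightarrow> L) (at_right 0)))"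

definition case_ii :: "(real \<Rightarrow> real) \<Rightarrow> real \<Rightarrow> bool" where
  "case_ii f \<epsilon> \<longleftrightarrow>
     (\<exists>f' f''. twice_deriv_on f {0<..\<epsilon>} f' f'' \<and> (\<forall>t\<in>{0<..\<epsilon>}. f'' t < 0) \<and>
        filterlim f' at_top (at_right 0))"

definition case_iii :: "(real \<Rightarrow> real) \<Rightarrow> real \<Rightarrow> bool" where
  "case_iii f \<epsilon> \<longleftrightarrow>
     (\<exists>f' f''. twice_deriv_on f {0..\<epsilon>} f' f'' \<and> (\<forall>t\<in>{0..\<epsilon>}. f'' t > 0) \<and> f' 0 \<noteq> 0)"

text \<open>\<open>d j\<close> is the \<open>j\<close>-th derivative of \<open>h\<close> on \<open>S\<close>.\<close>

definition Cm_derivs :: "nat \<Rightarrow> real set \<Rightarrow> (real \<Rightarrow> real) \<Rightarrow> (nat \<Rightarrow> real \<Rightarrow> real) \<Rightarrow> bool" where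
  "Cm_derivs m S h d \<longleftrightarrow> (\<forall>t\<in>S. d 0 t = h t) \<and>
     (\<forall>j<m. \<forall>t\<in>S. (d j has_real_derivative d (Suc j) t) (at t within S)) \<and>
     continuous_on S (d m)"

definition case_iv :: "(real \<Rightarrow> real) \<Rightarrow> real \<Rightarrow> (real \<Rightarrow> real) \<Rightarrow> nat \<Rightarrow> bool" where
  "case_iv f \<epsilon> h m \<longleftrightarrow>
     (\<exists>f' f''. twice_deriv_on f {0<..\<epsilon>} f' f'' \<and> (\<forall>t\<in>{0<..\<epsilon>}. f'' t > 0)) \<and>
     (f has_real_derivative 0) (at_right 0) \<and>
     (\<forall>t\<in>{0<..\<epsilon>}. h t = f t) \<and>
     (\<exists>d. Cm_derivs m {-\<epsilon>..\<epsilon>} h d \<and> (\<forall>j<m. d j 0 = 0) \<and> d m 0 \<noteq> 0)"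


section \<open>The constants\<close>

definition is_eps_K :: "real \<Rightarrow> (real \<Rightarrow> real) \<Rightarrow> real \<Rightarrow> bool" where
  "is_eps_K K f \<epsilon> \<longleftrightarrow> \<epsilon> > 0 \<and>
     (\<forall>PA PB. selector PA (graph_of f) \<longrightarrow> selector PB axis_B \<longrightarrow>
        (\<forall>x\<in>{0<..\<epsilon>}. norm (C_T PA PB (x, 0)) \<le> 1 / K * norm (x, 0::real)))"

definition is_delta_RIGHT :: "(real \<Rightarrow> real) \<Rightarrow> real \<Rightarrow> bool" where
  "is_delta_RIGHT f \<delta> \<longleftrightarrow> \<delta> > 0 \<and>
     (\<exists>M. \<forall>t\<in>{0<..\<delta>}. \<exists>D. (f has_real_derivative D) (at t within {0<..\<delta>}) \<and> D \<noteq> 0 \<and>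
        \<bar>t - f t / D\<bar> < M / 2 * t^2)"

text \<open>
  \<open>h\<close> lives on \<open>[-\<epsilon>, \<epsilon>]\<close>, so the inequality is only required there. Division by zero is harmless:
  for \<open>D = 0\<close> the inequality would read \<open>\<bar>t\<bar> < k \<bar>t\<bar>\<close> with \<open>k < 1\<close>.
\<close>

definition is_delta_LIN :: "real \<Rightarrow> (real \<Rightarrow> real) \<Rightarrow> nat \<Rightarrow> real \<Rightarrow> bool" where
  "is_delta_LIN \<epsilon> h m \<delta> \<longleftrightarrow> \<delta> > 0 \<and>
     (let k = 1/2 * ((real m - 1) / real m + 1) in
      \<forall>t\<in>{-\<epsilon>..\<epsilon>}. 0 < \<bar>t\<bar> \<and> \<bar>t\<bar> \<le> \<delta> \<longrightarrow>
        (\<exists>D. (h has_real_derivative D) (at t within {-\<epsilon>..\<epsilon>}) \<and> \<bar>t - h t / D\<bar> < k * \<bar>t\<bar>))"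


section \<open>Rates of convergence\<close>

definition never_worse :: "real \<Rightarrow> (nat \<Rightarrow> real \<times> real) \<Rightarrow> bool" where
  "never_worse q x \<longleftrightarrow> (\<forall>n. norm (x (Suc n)) \<le> q * norm (x n))"

definition finite_conv :: "(nat \<Rightarrow> real \<times> real) \<Rightarrow> bool" where
  "finite_conv x \<longleftrightarrow> (\<exists>n. x n = 0)"

definition quadratic_conv :: "(nat \<Rightarrow> real \<times> real) \<Rightarrow> bool" where
  "quadratic_conv x \<longleftrightarrow> (\<exists>M. \<forall>\<^sub>F n in sequentially. norm (x (Suc n)) \<le> M * (norm (x n))^2)"

definition superlinear_conv :: "(nat \<Rightarrow> real \<times> real) \<Rightarrow> bool" where
  "superlinear_conv x \<longleftrightarrow> (\<lambda>n. norm (x (Suc n)) / norm (x n)) \<longlonglongrightarrow> 0"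

definition linear_conv :: "(nat \<Rightarrow> real \<times> real) \<Rightarrow> bool" where
  "linear_conv x \<longleftrightarrow> (\<exists>k<1. \<forall>\<^sub>F n in sequentially. norm (x (Suc n)) \<le> k * norm (x n))"

end

theory Submission
  imports Defs
begin

text \<open>
  On the horizontal axis one step of \<open>C_T\<close> is a Newton step for \<open>f = \<bar>\<theta>\<bar>\<close>, taken at a point nearer
  to the root than the current iterate. Let \<open>(t, \<theta> t)\<close> be the selected nearest point of \<open>(x, 0)\<close> in
  the graph; call \<open>t\<close> a foot of \<open>x\<close>. The two reflected points are mirror images of each other in
  the axis, so their circumcenter with \<open>(x, 0)\<close> lies on the axis. It also lies on the perpendicular
  bisector of \<open>(x, 0)\<close> and its reflection, the line through \<open>(t, \<theta> t)\<close> orthogonal to the vector to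
  \<open>(x, 0)\<close>, which is the tangent of the graph. Its abscissa is therefore
  \<open>t + (\<theta> t)\<^sup>2 / (t - x)\<close>, and since \<open>x - t = f t * f' t\<close> at a minimum of the distance this
  equals \<open>t - f t / f' t\<close>. The formula gives \<open>t\<close> for \<open>\<theta> t = 0\<close>, so it also covers the collinear
  case (\<open>C_T_axis\<close>).

  For \<open>0 < x\<close> within the radius of the basic conditions, \<open>f\<close> increases up to \<open>2 * x\<close>, so a foot
  satisfies \<open>0 \<le> t < x\<close> (\<open>foot_cases\<close>). A foot at \<open>0\<close> sends the iterate to the origin, so every
  rate reduces to estimating \<open>t - f t / f' t\<close> for \<open>0 < t < x\<close>. The mean value theorem writes
  \<open>f t = t * f' z\<close> with \<open>0 < z < t\<close>, and the four shapes of \<open>f\<close> then give: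

  \<^item> If \<open>f'\<close> is differentiable at \<open>0\<close> with \<open>f' 0 > 0\<close>, then
    \<open>t - f t / f' t = t * (f' t - f' z) / f' t\<close> is of order \<open>t\<^sup>2\<close>
    (\<open>concave_quadratic_bound\<close>).
  \<^item> If \<open>f\<close> is concave with a vertical tangent, the new abscissa is not positive and its modulus is at
    most \<open>f t / f' t = (x - t) / (f' t)\<^sup>2\<close>, which is \<open>o(x)\<close>
    (\<open>vertical_superlinear_bound\<close>).
  \<^item> If \<open>f\<close> is convex, the Newton step stays in \<open>[0, t]\<close>, so the iterates never change side. If also
    \<open>f' 0 > 0\<close>, the move to the foot is by itself a contraction, and the Newton step is
    quadratic within the constant \<open>\<delta>\<close> (\<open>convex_transversal_bounds\<close>); at a multiple root the Newton
    step is itself a contraction within its constant \<open>\<delta>\<close> (\<open>convex_tangential_bounds\<close>).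

  In the two concave cases the iterates may jump across the origin; their convergence comes from the
  factor \<open>1 / K\<close> on both sides, where a point to the left of \<open>0\<close> is treated by reflecting the graph in
  the vertical axis. In the convex cases it comes from the contraction on the right.
\<close>

section \<open>Feet of perpendiculars from the axis\<close>

definition foot :: "(real \<Rightarrow> real) \<Rightarrow> real \<Rightarrow> real \<Rightarrow> bool" where
  "foot f x t \<longleftrightarrow> (\<forall>u. (x - t)\<^sup>2 + (f t)\<^sup>2 \<le> (x - u)\<^sup>2 + (f u)\<^sup>2)"

text \<open>
  Where \<open>f\<close> has a derivative \<open>D \<noteq> 0\<close> at a foot \<open>t\<close>, this is \<open>t - f t / D\<close>. The present form needs no
  derivative and depends on \<open>f\<close> through its square only, so it does not distinguish \<open>\<theta>\<close> from
  \<open>\<bar>\<theta>\<bar>\<close>. At \<open>t = x\<close> division by zero makes it \<open>x\<close>, the right value when \<open>x\<close> is a root.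
\<close>

definition crm_abscissa :: "(real \<Rightarrow> real) \<Rightarrow> real \<Rightarrow> real \<Rightarrow> real" where
  "crm_abscissa f x t = t + (f t)\<^sup>2 / (t - x)"

lemma foot_abs: "foot (\<lambda>t. \<bar>\<theta> t\<bar>) x t \<longleftrightarrow> foot \<theta> x t"
  by (simp add: foot_def)

lemma foot_reflect: "foot (\<lambda>t. \<bar>\<theta> (- t)\<bar>) (- x) (- t) \<longleftrightarrow> foot \<theta> x t"
proof
  assume L: "foot (\<lambda>t. \<bar>\<theta> (- t)\<bar>) (- x) (- t)"
  show "foot \<theta> x t"
    unfolding foot_def
  proof
    fix u
    from L have "(- x - - t)\<^sup>2 + (\<theta> t)\<^sup>2 \<le> (- x - - u)\<^sup>2 + (\<theta> u)\<^sup>2"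
      unfolding foot_def by (metis minus_minus power2_abs)
    then show "(x - t)\<^sup>2 + (\<theta> t)\<^sup>2 \<le> (x - u)\<^sup>2 + (\<theta> u)\<^sup>2"
      by (simp add: power2_eq_square algebra_simps)
  qed
next
  assume R: "foot \<theta> x t"
  show "foot (\<lambda>t. \<bar>\<theta> (- t)\<bar>) (- x) (- t)"
    unfolding foot_def
  proof
    fix u
    from R have "(x - t)\<^sup>2 + (\<theta> t)\<^sup>2 \<le> (x - - u)\<^sup>2 + (\<theta> (- u))\<^sup>2"
      unfolding foot_def by blast
    then show "(- x - - t)\<^sup>2 + \<bar>\<theta> (- (- t))\<bar>\<^sup>2 \<le> (- x - u)\<^sup>2 + \<bar>\<theta> (- u)\<bar>\<^sup>2"
      by (simp add: power2_eq_square algebra_simps)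
  qed
qed

lemma crm_abscissa_abs: "crm_abscissa (\<lambda>t. \<bar>\<theta> t\<bar>) x t = crm_abscissa \<theta> x t"
  by (simp add: crm_abscissa_def)

lemma crm_abscissa_reflect:
  "crm_abscissa (\<lambda>t. \<bar>\<theta> (- t)\<bar>) (- x) (- t) = - crm_abscissa \<theta> x t"
proof -
  have "- t - - x = - (t - x)" by simp
  then show ?thesis unfolding crm_abscissa_def by (simp only: divide_minus_right) simp
qed

lemma nearest_graph_axis_iff: "(t, \<theta> t) \<in> nearest (graph_of \<theta>) (x, 0) \<longleftrightarrow> foot \<theta> x t"
proof -
  let ?d = "\<lambda>v. norm ((x, 0) - v)"
  have bdd: "bdd_below (?d ` graph_of \<theta>)" by (rule bdd_belowI[of _ 0]) auto
  have mem: "(u, \<theta> u) \<in> graph_of \<theta>" for u by (auto simp: graph_of_def)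
  have d: "?d (u, \<theta> u) = sqrt ((x - u)\<^sup>2 + (\<theta> u)\<^sup>2)" for u by (simp add: norm_Pair)
  have "?d (t, \<theta> t) = (INF v\<in>graph_of \<theta>. ?d v) \<longleftrightarrow> (\<forall>u. ?d (t, \<theta> t) \<le> ?d (u, \<theta> u))"
  proof
    assume "?d (t, \<theta> t) = (INF v\<in>graph_of \<theta>. ?d v)"
    then show "\<forall>u. ?d (t, \<theta> t) \<le> ?d (u, \<theta> u)"
      using cINF_lower[OF bdd mem] by metis
  next
    assume le: "\<forall>u. ?d (t, \<theta> t) \<le> ?d (u, \<theta> u)"
    show "?d (t, \<theta> t) = (INF v\<in>graph_of \<theta>. ?d v)"
    proof (rule antisym)
      show "?d (t, \<theta> t) \<le> (INF v\<in>graph_of \<theta>. ?d v)"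
        using le mem[of t] by (intro cINF_greatest) (auto simp: graph_of_def)
      show "(INF v\<in>graph_of \<theta>. ?d v) \<le> ?d (t, \<theta> t)"
        by (rule cINF_lower[OF bdd mem])
    qed
  qed
  then show ?thesis unfolding nearest_def foot_def mem_Collect_eq d using mem by simp
qed

text \<open>
  Only arguments within \<open>\<bar>x\<bar>\<close> of \<open>x\<close> compete with the point \<open>(0, 0)\<close> of the graph, so the minimum may be
  taken over a compact interval. As \<open>f\<close> enters through its square, this also gives nearest
  points in a graph that is not closed, as long as \<open>\<bar>\<theta>\<bar>\<close> is continuous.
\<close>

lemma foot_exists:
  assumes cont: "continuous_on UNIV f" and f0: "f 0 = 0"
  shows "\<exists>t. foot f x t"
proof -
  let ?q = "\<lambda>u. (x - u)\<^sup>2 + (f u)\<^sup>2"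
  let ?I = "{x - \<bar>x\<bar>..x + \<bar>x\<bar>}"
  have "continuous_on ?I f" using cont continuous_on_subset by blast
  then have "continuous_on ?I ?q" by (intro continuous_intros)
  then obtain t where t: "t \<in> ?I" "\<forall>u\<in>?I. ?q t \<le> ?q u"
    using continuous_attains_inf[of ?I ?q] by auto
  have "?q t \<le> ?q u" for u
  proof (cases "u \<in> ?I")
    case False
    then have "\<bar>x\<bar> \<le> \<bar>x - u\<bar>" by auto
    then have "x\<^sup>2 \<le> (x - u)\<^sup>2" using abs_le_square_iff by blast
    moreover have "0 \<in> ?I" by auto
    then have "?q t \<le> ?q 0" using t(2) by blast
    then have "?q t \<le> x\<^sup>2" using f0 by simp
    ultimately show ?thesis using zero_le_power2[of "f u"] by linarith
  qed (use t in auto)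
  then show ?thesis unfolding foot_def by blast
qed

lemma selector_axis_foot:
  assumes sel: "selector P (graph_of \<theta>)" and ex: "\<exists>t. foot \<theta> x t"
  obtains t where "P (x, 0) = (t, \<theta> t)" "foot \<theta> x t"
proof -
  have "nearest (graph_of \<theta>) (x, 0) \<noteq> {}" using ex nearest_graph_axis_iff by blast
  then have m: "P (x, 0) \<in> nearest (graph_of \<theta>) (x, 0)" using sel by (auto simp: selector_def)
  then obtain t where t: "P (x, 0) = (t, \<theta> t)" by (auto simp: nearest_def graph_of_def)
  with m have "foot \<theta> x t" using nearest_graph_axis_iff by metis
  with t show thesis using that by blast
qed

text \<open>
  The constants that bound the step in the concave cases speak about all selectors of the graph of
  \<open>\<bar>\<theta>\<bar>\<close>. Each foot is the choice of some selector, so such a bound holds at every foot.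
\<close>

lemma selector_through_foot:
  assumes "foot \<theta> x t"
  obtains P where "selector P (graph_of \<theta>)" "P (x, 0) = (t, \<theta> t)"
proof
  let ?P = "\<lambda>z. if z = (x, 0) then (t, \<theta> t) else (SOME w. w \<in> nearest (graph_of \<theta>) z)"
  show "selector ?P (graph_of \<theta>)"
    unfolding selector_def using nearest_graph_axis_iff[of t \<theta> x] assms some_in_eq by auto
qed simp


section \<open>The reflections and the circumcenter in coordinates\<close>

lemma selector_axis_B:
  assumes "selector PB axis_B"
  shows "PB (a, b) = (a, 0)"
proof -
  let ?d = "\<lambda>v. norm ((a, b) - v)"
  have bdd: "bdd_below (?d ` axis_B)" by (rule bdd_belowI[of _ 0]) auto
  have dist_ge: "\<bar>b\<bar> \<le> ?d v" if "v \<in> axis_B" for v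
    using that by (auto simp: axis_B_def norm_Pair)
  have inf: "(INF v\<in>axis_B. ?d v) = \<bar>b\<bar>"
  proof (rule antisym)
    have "(INF v\<in>axis_B. ?d v) \<le> ?d (a, 0)"
      by (rule cINF_lower[OF bdd]) (simp add: axis_B_def)
    then show "(INF v\<in>axis_B. ?d v) \<le> \<bar>b\<bar>" by (simp add: norm_Pair)
    show "\<bar>b\<bar> \<le> (INF v\<in>axis_B. ?d v)"
      using dist_ge by (intro cINF_greatest) (auto simp: axis_B_def)
  qed
  have "(a, 0) \<in> nearest axis_B (a, b)"
    unfolding nearest_def using inf by (simp add: axis_B_def norm_Pair)
  then have m: "PB (a, b) \<in> nearest axis_B (a, b)" using assms by (auto simp: selector_def)
  then obtain c where c: "PB (a, b) = (c, 0)" by (auto simp: nearest_def axis_B_def)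
  have "?d (c, 0) = \<bar>b\<bar>" using m c inf by (simp add: nearest_def)
  then have "(sqrt ((a - c)\<^sup>2 + b\<^sup>2))\<^sup>2 = b\<^sup>2" by (simp add: norm_Pair)
  then have "(a - c)\<^sup>2 = 0" by simp
  then show ?thesis using c by simp
qed

lemma not_collinear_isosceles:
  fixes x t s :: real
  assumes "s \<noteq> 0" "t \<noteq> x"
  shows "\<not> collinear {(x, 0), (2 * t - x, 2 * s), (2 * t - x, - 2 * s)}"
proof
  assume "collinear {(x, 0), (2 * t - x, 2 * s), (2 * t - x, - 2 * s)}"
  then obtain u where u: "\<forall>y\<in>{(x, 0), (2 * t - x, 2 * s), (2 * t - x, - 2 * s)}.
      \<forall>z\<in>{(x, 0), (2 * t - x, 2 * s), (2 * t - x, - 2 * s)}. \<exists>c. y - z = c *\<^sub>R u"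
    unfolding collinear_def by blast
  from u obtain c where c: "(2 * t - x, 2 * s) - (2 * t - x, - 2 * s) = c *\<^sub>R u" by blast
  from u obtain d where d: "(2 * t - x, 2 * s) - (x, 0) = d *\<^sub>R u" by blast
  obtain u1 u2 where "u = (u1, u2)" by force
  with c d have "c * u1 = 0" "c * u2 = 4 * s" "d * u1 = 2 * (t - x)" by auto
  with assms show False by auto
qed

text \<open>
  The second and third points are mirror images in the axis, which forces the second
  coordinate of the circumcenter to be \<open>0\<close>. Equal distance to the first two points then says
  \<open>(c - t) * (t - x) = s\<^sup>2\<close> for its abscissa \<open>c\<close>.
\<close>

lemma circumcenter_isosceles:
  fixes x t s :: real
  assumes "s \<noteq> 0" "t \<noteq> x"
  shows "circumcenter (x, 0) (2 * t - x, 2 * s) (2 * t - x, - 2 * s) = (t + s\<^sup>2 / (t - x), 0)"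
proof -
  let ?c = "t + s\<^sup>2 / (t - x)"
  have eq: "(?c - t) * (t - x) = s\<^sup>2" using assms by simp
  have "(c - x)\<^sup>2 = (c - (2 * t - x))\<^sup>2 + (2 * s)\<^sup>2" if "(c - t) * (t - x) = s\<^sup>2" for c
    using that by algebra
  from this[OF eq] have c2: "dist (?c, 0) (x, 0) = dist (?c, 0) (2 * t - x, 2 * s)"
    by (simp add: dist_Pair_Pair dist_real_def)
  have c3: "dist (?c, 0) (2 * t - x, 2 * s) = dist (?c, 0) (2 * t - x, - 2 * s)"
    by (simp add: dist_Pair_Pair dist_real_def)
  \<comment> \<open>Barycentric coordinates \<open>a, (1 - a) / 2, (1 - a) / 2\<close>: equal weights on the mirror images.\<close>
  define a where "a = (?c - 2 * t + x) / (2 * (x - t))"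
  have a: "a * (2 * (x - t)) = ?c - 2 * t + x" using assms by (simp add: a_def)
  have hull: "(?c, 0) \<in> affine hull {(x, 0), (2 * t - x, 2 * s), (2 * t - x, - 2 * s)}"
    unfolding affine_hull_3
  proof (intro CollectI exI conjI)
    show "a + (1 - a) / 2 + (1 - a) / 2 = 1" by (simp add: field_simps)
    show "(?c, 0) = a *\<^sub>R (x, 0) + ((1 - a) / 2) *\<^sub>R (2 * t - x, 2 * s)
        + ((1 - a) / 2) *\<^sub>R (2 * t - x, - 2 * s)"
      using a by (simp add: algebra_simps field_simps)
  qed
  show ?thesis
    unfolding circumcenter_def
  proof (rule the_equality)
    fix z assume z: "z \<in> affine hull {(x, 0), (2 * t - x, 2 * s), (2 * t - x, - 2 * s)} \<and>
      dist z (x, 0) = dist z (2 * t - x, 2 * s) \<and>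
      dist z (2 * t - x, 2 * s) = dist z (2 * t - x, - 2 * s)"
    obtain p q where pq: "z = (p, q)" by force
    from z have "(p - x)\<^sup>2 + q\<^sup>2 = (p - (2 * t - x))\<^sup>2 + (q - 2 * s)\<^sup>2"
      and "(p - (2 * t - x))\<^sup>2 + (q - 2 * s)\<^sup>2 = (p - (2 * t - x))\<^sup>2 + (q + 2 * s)\<^sup>2"
      unfolding pq by (auto simp: dist_Pair_Pair dist_real_def)
    then have "q * s = 0" "(p - t) * (t - x) + q * s = s\<^sup>2"
      by algebra+
    then have "q = 0" "p = ?c" using assms by (auto simp: field_simps)
    then show "z = (?c, 0)" using pq by simp
  qed (use hull c2 c3 in blast)
qed

text \<open>
  Where \<open>\<theta> t \<noteq> 0\<close> and \<open>t \<noteq> x\<close>, the three points form a triangle and the step is its circumcenter. If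
  \<open>\<theta> t = 0\<close>, both reflections coincide, and the averaged double reflection returns the foot itself.
  The case \<open>t = x\<close>, \<open>\<theta> t \<noteq> 0\<close> has to be excluded because there the step is \<open>(x, - \<theta> x)\<close>, which leaves
  the axis.
\<close>

lemma C_T_axis:
  assumes PB: "selector PB axis_B" and PA: "PA (x, 0) = (t, \<theta> t)" and ok: "t \<noteq> x \<or> \<theta> t = 0"
  shows "C_T PA PB (x, 0) = (crm_abscissa \<theta> x t, 0)"
proof -
  have RA: "refl_op PA (x, 0) = (2 * t - x, 2 * \<theta> t)"
    by (simp add: refl_op_def PA)
  have RB: "refl_op PB (2 * t - x, 2 * \<theta> t) = (2 * t - x, - 2 * \<theta> t)"
    by (simp add: refl_op_def selector_axis_B[OF PB])
  show ?thesis
  proof (cases "\<theta> t = 0")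
    case True
    then have "collinear {(x, 0), refl_op PA (x, 0), refl_op PB (refl_op PA (x, 0))}"
      unfolding RA RB by simp
    then show ?thesis
      using True RB by (simp add: C_T_def DR_op_def RA crm_abscissa_def diff_divide_distrib)
  next
    case False
    then show ?thesis
      using ok not_collinear_isosceles[of "\<theta> t" t x] circumcenter_isosceles[of "\<theta> t" t x]
      by (simp add: C_T_def CRM_def RA RB[simplified] crm_abscissa_def)
  qed
qed

lemma is_eps_K_bound:
  assumes K: "is_eps_K K f e" and x: "0 < x" "x \<le> e" and ft: "foot f x t" and tx: "t \<noteq> x"
    and PB: "selector PB axis_B"
  shows "\<bar>crm_abscissa f x t\<bar> \<le> 1 / K * x"
proof -
  obtain P where P: "selector P (graph_of f)" "P (x, 0) = (t, f t)"
    using selector_through_foot[OF ft] by blast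
  have "norm (C_T P PB (x, 0)) \<le> 1 / K * norm (x, 0::real)"
    using K P PB x unfolding is_eps_K_def by auto
  then show ?thesis
    using C_T_axis[where PA = P and \<theta> = f, OF PB P(2)] tx x by (simp add: norm_Pair)
qed


section \<open>The step as a Newton step at the foot\<close>

lemma eps_of_bounds: "eps_of a1 a2 a3 \<le> a1" "2 * eps_of a1 a2 a3 \<le> a2"
  by (auto simp: eps_of_def)

lemma eps_of_pos: "basic_conditions f a1 a2 a3 \<Longrightarrow> 0 < eps_of a1 a2 a3"
  by (auto simp: eps_of_def basic_conditions_def B2_def B4_def B5_def)

lemma basic_conditions_zero: "basic_conditions f a1 a2 a3 \<Longrightarrow> f 0 = 0"
  by (auto simp: basic_conditions_def B2_def)

lemma basic_conditions_continuous: "basic_conditions f a1 a2 a3 \<Longrightarrow> continuous_on S f"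
  by (auto simp: basic_conditions_def B1_def intro: continuous_on_subset)

lemma basic_conditions_deriv:
  assumes "basic_conditions f a1 a2 a3" "0 < t" "t < a2"
  obtains D where "(f has_real_derivative D) (at t)" "D \<noteq> 0"
proof -
  from assms obtain D where D: "D \<noteq> 0"
    "(f has_real_derivative D) (at t within ({-a2..a2} - {0}))"
    by (force simp: basic_conditions_def B4_def)
  moreover have "at t within ({-a2..a2} - {0}) = at t"
    by (rule at_within_open_subset[of _ "{0<..<a2}"]) (use assms in auto)
  ultimately show thesis using that by metis
qed

text \<open>
  Comparing with the point \<open>(0, 0)\<close> of the graph puts a foot in \<open>[0, 2 * x]\<close>, the reason why the radius
  contains half of the interval on which the derivative is known not to vanish. A foot
  beyond \<open>x\<close> would have \<open>f t < f x\<close>, as otherwise \<open>(x, f x)\<close> is nearer; then \<open>f\<close>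
  takes the value \<open>f t\<close> to the left of \<open>x\<close> as well, against Rolle's theorem.
  The remaining facts are the stationarity of the squared distance at \<open>t\<close>, which also excludes
  \<open>t = x\<close>: there it would give \<open>f x * D = 0\<close>.
\<close>

lemma foot_cases:
  assumes bc: "basic_conditions f a1 a2 a3" and nonneg: "\<And>u. 0 \<le> f u"
    and x: "0 < x" "x \<le> eps_of a1 a2 a3" and ft: "foot f x t"
  shows "t = 0 \<or> (0 < t \<and> t < x \<and> 0 < f t \<and>
    (\<exists>D>0. (f has_real_derivative D) (at t) \<and> x - t = f t * D \<and>
       crm_abscissa f x t = t - f t / D))"
proof -
  have f0: "f 0 = 0" using basic_conditions_zero[OF bc] .
  have xa: "x \<le> a1" "2 * x \<le> a2" using x eps_of_bounds[of a1 a2 a3] by linarith+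
  have root: "u = 0" if "f u = 0" "0 \<le> u" "u \<le> x" for u
    using bc that xa by (auto simp: basic_conditions_def B2_def)
  have "(x - t)\<^sup>2 + (f t)\<^sup>2 \<le> x\<^sup>2" using ft[unfolded foot_def, rule_format, of 0] f0 by simp
  then have "(x - t)\<^sup>2 \<le> x\<^sup>2" using zero_le_power2[of "f t"] by linarith
  then have "\<bar>x - t\<bar> \<le> \<bar>x\<bar>" using abs_le_square_iff by blast
  then have t: "0 \<le> t" "t \<le> 2 * x" using x by linarith+
  have "t \<le> x"
  proof (rule ccontr)
    assume "\<not> t \<le> x"
    then have tx: "x < t" by simp
    show False
    proof (cases "f x \<le> f t")
      case True
      then have "(f x)\<^sup>2 \<le> (f t)\<^sup>2" using nonneg by (simp add: power_mono)
      moreover have "(x - t)\<^sup>2 + (f t)\<^sup>2 \<le> (f x)\<^sup>2"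
        using ft[unfolded foot_def, rule_format, of x] by simp
      moreover have "(x - t)\<^sup>2 > 0" using tx by simp
      ultimately show False by linarith
    next
      case False
      have "\<exists>u\<ge>0. u \<le> x \<and> f u = f t"
        using False f0 nonneg x basic_conditions_continuous[OF bc] by (intro IVT') auto
      then obtain u where u: "0 \<le> u" "u \<le> x" "f u = f t" by blast
      have "\<exists>z>u. z < t \<and> (f has_real_derivative 0) (at z)"
      proof (rule Rolle)
        fix z assume "u < z" "z < t"
        then have "0 < z" "z < a2" using u t xa by linarith+
        then show "f differentiable (at z)"
          using basic_conditions_deriv[OF bc] real_differentiable_def by metis
      qed (use u tx basic_conditions_continuous[OF bc] in auto)
      then obtain z where z: "u < z" "z < t" "(f has_real_derivative 0) (at z)" by blast
      have "0 < z" "z < a2" using z u t xa by linarith+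
      then obtain D where "(f has_real_derivative D) (at z)" "D \<noteq> 0"
        using basic_conditions_deriv[OF bc] by blast
      with z(3) show False using DERIV_unique by blast
    qed
  qed
  show ?thesis
  proof (cases "t = 0")
    case False
    then have t0: "0 < t" using t by simp
    then have ft0: "0 < f t" using root[of t] \<open>t \<le> x\<close> nonneg[of t] by force
    have "t < a2" using \<open>t \<le> x\<close> xa x by linarith
    then obtain D where D: "(f has_real_derivative D) (at t)" "D \<noteq> 0"
      using basic_conditions_deriv[OF bc t0] by blast
    have "((\<lambda>u. (x - u)\<^sup>2 + (f u)\<^sup>2) has_real_derivative (2 * (t - x) + 2 * f t * D)) (at t)"
      by (rule derivative_eq_intros D refl | simp add: algebra_simps)+
    then have "2 * (t - x) + 2 * f t * D = 0"
      by (rule DERIV_local_min[where d = 1]) (use ft in \<open>auto simp: foot_def\<close>)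
    then have xt: "x - t = f t * D" by simp
    have "x \<noteq> t" using xt ft0 D(2) by auto
    with \<open>t \<le> x\<close> have tx: "t < x" by simp
    have "0 < D" using xt tx ft0 by (metis diff_gt_0_iff_gt zero_less_mult_pos)
    moreover have "crm_abscissa f x t = t - f t / D"
    proof -
      have "t - x = - (f t * D)" using xt by simp
      then have "(f t)\<^sup>2 / (t - x) = - (f t / D)"
        using ft0 D(2) by (simp add: power2_eq_square)
      then show ?thesis by (simp add: crm_abscissa_def)
    qed
    ultimately show ?thesis using t0 tx ft0 D(1) xt by blast
  qed simp
qed

lemma foot_less:
  assumes "basic_conditions f a1 a2 a3" "\<And>u. 0 \<le> f u" "0 < x" "x \<le> eps_of a1 a2 a3" "foot f x t"
  shows "t < x"
  using foot_cases[OF assms] assms(3) by auto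

text \<open>
  A foot of \<open>x\<close> lies strictly below \<open>x\<close>, hence inside the interval on which the derivatives are
  prescribed, so one-sided derivatives at the right end point never enter.
\<close>

lemma twice_deriv_on_interior:
  assumes "twice_deriv_on f S f' f''" "{0<..<e} \<subseteq> S" "0 < t" "t < e"
  shows "(f has_real_derivative f' t) (at t)" "(f' has_real_derivative f'' t) (at t)"
proof -
  have "at t within S = at t"
    by (rule at_within_open_subset[of _ "{0<..<e}"]) (use assms in auto)
  moreover have "t \<in> S" using assms by auto
  ultimately show "(f has_real_derivative f' t) (at t)" "(f' has_real_derivative f'' t) (at t)"
    using assms(1) unfolding twice_deriv_on_def by metis+
qed

lemma secant_slope:
  fixes f :: "real \<Rightarrow> real"
  assumes "continuous_on {0..t} f" "f 0 = 0" "0 < t"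
    and D: "\<And>u. 0 < u \<Longrightarrow> u < t \<Longrightarrow> (f has_real_derivative f' u) (at u)"
  obtains z where "0 < z" "z < t" "f t = t * f' z"
proof -
  obtain l z where z: "0 < z" "z < t" "(f has_real_derivative l) (at z)" "f t - f 0 = (t - 0) * l"
    using MVT[of 0 t f] assms real_differentiable_def by metis
  then have "l = f' z" using D DERIV_unique by blast
  with z assms(2) show thesis by (intro that[of z]) auto
qed

text \<open>
  The numerator in \<open>t * (f' t - f' z) / f' t\<close> is controlled by a Lipschitz estimate for \<open>f'\<close> at \<open>0\<close>
  only: with \<open>\<bar>f' u - f' 0\<bar> \<le> C * u\<close> near \<open>0\<close>, both \<open>f' t\<close> and \<open>f' z\<close> are within \<open>C * t\<close> of \<open>f' 0\<close>. The
  denominator stays above half the limit \<open>L\<close> of \<open>f'\<close>, which equals \<open>f' 0\<close> by continuity.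
\<close>

lemma concave_quadratic_bound:
  assumes bc: "basic_conditions f a1 a2 a3" and nonneg: "\<And>u. 0 \<le> f u"
    and c: "case_i f (eps_of a1 a2 a3)"
  shows "\<exists>d>0. \<exists>M. \<forall>x t. 0 < x \<and> x \<le> eps_of a1 a2 a3 \<and> x < d \<and> foot f x t \<longrightarrow>
    \<bar>crm_abscissa f x t\<bar> \<le> M * x\<^sup>2"
proof -
  define e where "e = eps_of a1 a2 a3"
  have e0: "0 < e" using eps_of_pos[OF bc] by (simp add: e_def)
  obtain f' f'' L where td: "twice_deriv_on f {0..e} f' f''" and L: "0 < L" "(f' \<longlongrightarrow> L) (at_right 0)"
    using c by (auto simp: case_i_def e_def)
  have right: "at 0 within {0..e} = at_right 0"
    using e0 by (rule at_within_Icc_at_right)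
  have d0: "(f' has_real_derivative f'' 0) (at_right 0)"
    using td e0 right unfolding twice_deriv_on_def by (metis atLeastAtMost_iff order_refl less_imp_le)
  then have "(f' \<longlongrightarrow> f' 0) (at_right 0)"
    using DERIV_continuous continuous_within by blast
  then have fL: "f' 0 = L" using L(2) tendsto_unique trivial_limit_at_right_real by blast
  define C where "C = \<bar>f'' 0\<bar> + 1"
  have "((\<lambda>u. \<bar>(f' u - f' 0) / (u - 0)\<bar>) \<longlongrightarrow> \<bar>f'' 0\<bar>) (at_right 0)"
    using d0 unfolding has_field_derivative_iff by (rule tendsto_rabs)
  then have "eventually (\<lambda>u. \<bar>(f' u - f' 0) / (u - 0)\<bar> < C) (at_right 0)"
    by (rule order_tendstoD(2)) (simp add: C_def)
  moreover have "eventually (\<lambda>u. L / 2 < f' u) (at_right 0)"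
    by (rule order_tendstoD(1)[OF L(2)]) (use L(1) in simp)
  ultimately have "eventually (\<lambda>u. \<bar>(f' u - f' 0) / (u - 0)\<bar> < C \<and> L / 2 < f' u) (at_right 0)"
    by (rule eventually_conj)
  then obtain d where d: "0 < d"
    "\<And>u. 0 < u \<Longrightarrow> u < d \<Longrightarrow> \<bar>(f' u - f' 0) / (u - 0)\<bar> < C \<and> L / 2 < f' u"
    unfolding eventually_at_right_field by blast
  have lip: "\<bar>f' u - L\<bar> \<le> C * u" if "0 < u" "u < d" for u
    using d(2)[OF that] that by (simp add: fL abs_divide divide_less_eq)
  have C0: "0 < C" by (simp add: C_def)
  show ?thesis
  proof (intro exI conjI allI impI)
    fix x t assume xt: "0 < x \<and> x \<le> eps_of a1 a2 a3 \<and> x < d \<and> foot f x t"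
    then have x: "0 < x" "x \<le> eps_of a1 a2 a3" "x < d" and ft: "foot f x t" by auto
    show "\<bar>crm_abscissa f x t\<bar> \<le> (4 * C / L) * x\<^sup>2"
    proof (cases "t = 0")
      case True
      then show ?thesis
        using basic_conditions_zero[OF bc] C0 L(1) by (simp add: crm_abscissa_def)
    next
      case False
      then obtain D where t: "0 < t" "t < x" and D: "0 < D" "(f has_real_derivative D) (at t)"
        "crm_abscissa f x t = t - f t / D"
        using foot_cases[OF bc nonneg x(1,2) ft] by blast
      have sub: "{0<..<e} \<subseteq> {0..e}" by auto
      have der: "(f has_real_derivative f' u) (at u)" if "0 < u" "u \<le> t" for u
        using twice_deriv_on_interior(1)[OF td sub, of u] that t x e_def by simp
      have DD: "D = f' t" using der[of t] t D(2) DERIV_unique by blast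
      obtain z where z: "0 < z" "z < t" "f t = t * f' z"
        using secant_slope[OF basic_conditions_continuous[OF bc] basic_conditions_zero[OF bc] t(1)] der
        by (metis less_imp_le)
      have "\<bar>f' t - f' z\<bar> \<le> C * t + C * z" using lip[of t] lip[of z] t z x by linarith
      also have "\<dots> \<le> 2 * C * t" using z C0 by simp
      finally have "\<bar>f' t - f' z\<bar> \<le> 2 * C * t" .
      then have num: "t * \<bar>f' t - f' z\<bar> \<le> t * (2 * C * t)" using t by (intro mult_left_mono) auto
      have half: "L / 2 \<le> f' t" using d(2)[of t] t x by auto
      have "crm_abscissa f x t = t * (f' t - f' z) / f' t"
        using D(1) unfolding D(3) DD z(3) by (simp add: field_simps)
      then have "\<bar>crm_abscissa f x t\<bar> = t * \<bar>f' t - f' z\<bar> / f' t"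
        using t D(1) DD by (simp add: abs_mult)
      also have "\<dots> \<le> t * (2 * C * t) / (L / 2)"
        using num half L(1) t C0 by (intro frac_le) auto
      also have "\<dots> = (4 * C / L) * t\<^sup>2" by (simp add: power2_eq_square)
      also have "\<dots> \<le> (4 * C / L) * x\<^sup>2"
        using t C0 L(1) by (intro mult_left_mono power_mono) auto
      finally show ?thesis .
    qed
  qed (rule d(1))
qed

text \<open>
  Concavity makes the chord from \<open>0\<close> steeper than the tangent at \<open>t\<close>, so the tangent meets the axis
  at a point that is not positive and the modulus of the step is at most \<open>f t / f' t\<close>. Rewriting
  this as \<open>(x - t) / (f' t)\<^sup>2\<close> by stationarity shows the gain, since \<open>f'\<close> tends to infinity.
\<close>

lemma vertical_superlinear_bound:
  assumes bc: "basic_conditions f a1 a2 a3" and nonneg: "\<And>u. 0 \<le> f u"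
    and c: "case_ii f (eps_of a1 a2 a3)" and eta: "0 < \<eta>"
  shows "\<exists>d>0. \<forall>x t. 0 < x \<and> x \<le> eps_of a1 a2 a3 \<and> x < d \<and> foot f x t \<longrightarrow>
    \<bar>crm_abscissa f x t\<bar> \<le> \<eta> * x"
proof -
  define e where "e = eps_of a1 a2 a3"
  obtain f' f'' where td: "twice_deriv_on f {0<..e} f' f''" "\<forall>t\<in>{0<..e}. f'' t < 0"
    and lim: "filterlim f' at_top (at_right 0)"
    using c by (auto simp: case_ii_def e_def)
  \<comment> \<open>The lower bound \<open>1\<close> gives \<open>N\<^sup>2 \<ge> N \<ge> 1 / \<eta>\<close>.\<close>
  define N where "N = max 1 (1 / \<eta>)"
  have "eventually (\<lambda>u. N \<le> f' u) (at_right 0)"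
    using lim by (simp add: filterlim_at_top)
  then obtain d where d: "0 < d" "\<And>u. 0 < u \<Longrightarrow> u < d \<Longrightarrow> N \<le> f' u"
    unfolding eventually_at_right_field by blast
  show ?thesis
  proof (intro exI conjI allI impI)
    fix x t assume xt: "0 < x \<and> x \<le> eps_of a1 a2 a3 \<and> x < d \<and> foot f x t"
    then have x: "0 < x" "x \<le> eps_of a1 a2 a3" "x < d" and ft: "foot f x t" by auto
    show "\<bar>crm_abscissa f x t\<bar> \<le> \<eta> * x"
    proof (cases "t = 0")
      case True
      then show ?thesis
        using basic_conditions_zero[OF bc] eta x by (simp add: crm_abscissa_def)
    next
      case False
      then obtain D where t: "0 < t" "t < x" "0 < f t" and D: "0 < D" "(f has_real_derivative D) (at t)"
        "x - t = f t * D" "crm_abscissa f x t = t - f t / D"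
        using foot_cases[OF bc nonneg x(1,2) ft] by blast
      have sub: "{0<..<e} \<subseteq> {0<..e}" by auto
      have der: "(f has_real_derivative f' u) (at u)" "(f' has_real_derivative f'' u) (at u)" "f'' u < 0"
        if "0 < u" "u \<le> t" for u
        using twice_deriv_on_interior[OF td(1) sub, of u] td(2) that t x e_def by auto
      have DD: "D = f' t" using der(1)[of t] t D(2) DERIV_unique by blast
      obtain z where z: "0 < z" "z < t" "f t = t * f' z"
        using secant_slope[OF basic_conditions_continuous[OF bc] basic_conditions_zero[OF bc] t(1)] der(1)
        by (metis less_imp_le)
      have "f' t < f' z"
        by (rule DERIV_neg_imp_decreasing[OF z(2)]) (use der z in \<open>meson less_le_trans\<close>)
      then have "t \<le> f t / D" using t D(1) DD z(3) by (simp add: field_simps)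
      then have "\<bar>crm_abscissa f x t\<bar> \<le> f t / D" using D(4) t by simp
      also have "\<dots> = (x - t) / D\<^sup>2" using D(1,3) by (simp add: power2_eq_square)
      also have "\<dots> \<le> x / (1 / \<eta>)"
      proof (rule frac_le)
        have "N \<le> D" using d(2)[of t] t x DD by simp
        then have "1 \<le> D" "1 / \<eta> \<le> D" by (auto simp: N_def)
        then show "1 / \<eta> \<le> D\<^sup>2" using self_le_power[of D 2] by linarith
      qed (use t x eta in auto)
      finally show ?thesis by (simp add: mult.commute)
    qed
  qed (rule d(1))
qed

text \<open>
  For convex \<open>f\<close> the chord from \<open>0\<close> is flatter than the tangent at \<open>t\<close>; equivalently the Newton step
  from \<open>t\<close> does not cross the origin.
\<close>

lemma convex_le_slope_times:
  assumes bc: "basic_conditions f a1 a2 a3" and t: "0 < t" "t < e"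
    and td: "twice_deriv_on f S f' f''" "{0<..<e} \<subseteq> S" "\<forall>u\<in>S. 0 < f'' u"
  shows "f t \<le> t * f' t"
proof -
  have der: "(f has_real_derivative f' u) (at u)" "(f' has_real_derivative f'' u) (at u)" "0 < f'' u"
    if "0 < u" "u \<le> t" for u
    using twice_deriv_on_interior[OF td(1,2), of u] subsetD[OF td(2), of u] td(3) that t by auto
  obtain z where z: "0 < z" "z < t" "f t = t * f' z"
    using secant_slope[OF basic_conditions_continuous[OF bc] basic_conditions_zero[OF bc] t(1)] der(1)
    by (metis less_imp_le)
  have "f' z < f' t"
    by (rule DERIV_pos_imp_increasing[OF z(2)]) (use der z in \<open>meson less_le_trans\<close>)
  then show ?thesis using z(3) t by simp
qed

text \<open>
  The quadratic estimate alone does not force convergence from all of the interval, because its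
  constant may be large. A contraction factor comes from the move to the foot: with \<open>m = f' 0 > 0\<close>
  convexity gives \<open>f' \<ge> m\<close> and \<open>f t \<ge> m * t\<close>, so \<open>x = t + f t * f' t \<ge> (1 + m\<^sup>2) * t\<close>, while the
  Newton step from \<open>t\<close> stays in \<open>[0, t]\<close>.
\<close>

lemma convex_transversal_bounds:
  assumes bc: "basic_conditions f a1 a2 a3" and nonneg: "\<And>u. 0 \<le> f u"
    and c: "case_iii f (eps_of a1 a2 a3)" and R: "is_delta_RIGHT f \<delta>"
  shows "\<exists>q M. 0 \<le> q \<and> q < 1 \<and> (\<forall>x t. 0 < x \<and> x \<le> eps_of a1 a2 a3 \<and> x \<le> \<delta> \<and> foot f x t \<longrightarrow>
      0 \<le> crm_abscissa f x t \<and> crm_abscissa f x t \<le> q * x \<and> \<bar>crm_abscissa f x t\<bar> \<le> M * x\<^sup>2)"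
proof -
  define e where "e = eps_of a1 a2 a3"
  have e0: "0 < e" using eps_of_pos[OF bc] by (simp add: e_def)
  have f0: "f 0 = 0" using basic_conditions_zero[OF bc] .
  obtain f' f'' where td: "twice_deriv_on f {0..e} f' f''" "\<forall>t\<in>{0..e}. 0 < f'' t" "f' 0 \<noteq> 0"
    using c by (auto simp: case_iii_def e_def)
  obtain M where M: "\<forall>t\<in>{0<..\<delta>}. \<exists>D. (f has_real_derivative D) (at t within {0<..\<delta>}) \<and> D \<noteq> 0 \<and>
        \<bar>t - f t / D\<bar> < M / 2 * t\<^sup>2"
    using R by (auto simp: is_delta_RIGHT_def)
  have right: "at 0 within {0..e} = at_right 0"
    using e0 by (rule at_within_Icc_at_right)
  have "(f has_real_derivative f' 0) (at_right 0)"
    using td(1) e0 right unfolding twice_deriv_on_def by (metis atLeastAtMost_iff order_refl less_imp_le)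
  then have lim: "((\<lambda>u. (f u - f 0) / (u - 0)) \<longlongrightarrow> f' 0) (at_right 0)"
    unfolding has_field_derivative_iff .
  have "eventually (\<lambda>u. 0 \<le> (f u - f 0) / (u - 0)) (at_right 0)"
    unfolding eventually_at_right_field using nonneg f0 by (intro exI[of _ 1]) auto
  then have "0 \<le> f' 0"
    using tendsto_lowerbound[OF lim] trivial_limit_at_right_real by blast
  then have m0: "0 < f' 0" using td(3) by simp
  define m where "m = f' 0"
  \<comment> \<open>\<open>M / 2 * \<delta>\<^sup>2\<close> dominates an absolute value.\<close>
  have M0: "0 \<le> M / 2" if "0 < \<delta>"
  proof -
    have dmem: "\<delta> \<in> {0<..\<delta>}" using that by simp
    obtain D where "\<bar>\<delta> - f \<delta> / D\<bar> < M / 2 * \<delta>\<^sup>2" using M dmem by blast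
    then have "0 < M / 2 * \<delta>\<^sup>2" using abs_ge_zero[of "\<delta> - f \<delta> / D"] by linarith
    then show ?thesis using that by (simp add: zero_less_mult_iff)
  qed
  show ?thesis
  proof (intro exI conjI)
    show "0 \<le> 1 / (1 + m\<^sup>2)" "1 / (1 + m\<^sup>2) < 1" using m0 by (auto simp: m_def add_pos_pos)
  next
    have "0 \<le> crm_abscissa f x t \<and> crm_abscissa f x t \<le> 1 / (1 + m\<^sup>2) * x \<and>
        \<bar>crm_abscissa f x t\<bar> \<le> M / 2 * x\<^sup>2"
      if x: "0 < x" "x \<le> eps_of a1 a2 a3" "x \<le> \<delta>" and ft: "foot f x t" for x t
    proof (cases "t = 0")
      case True
      then show ?thesis using f0 M0 x by (simp add: crm_abscissa_def)
    next
      case False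
      then obtain D where t: "0 < t" "t < x" "0 < f t" and D: "0 < D" "(f has_real_derivative D) (at t)"
        "x - t = f t * D" "crm_abscissa f x t = t - f t / D"
        using foot_cases[OF bc nonneg x(1,2) ft] by blast
      have sub: "{0<..<e} \<subseteq> {0..e}" by auto
      have te: "t < e" using t x e_def by simp
      have DD: "D = f' t" using twice_deriv_on_interior(1)[OF td(1) sub t(1) te] D(2) DERIV_unique by blast
      have "f t \<le> t * D" using convex_le_slope_times[OF bc t(1) te td(1) sub td(2)] DD by simp
      then have lo: "0 \<le> crm_abscissa f x t" unfolding D(4) using D(1) by (simp add: divide_le_eq)
      have mono: "m \<le> f' u" if "0 < u" "u \<le> t" for u
      proof -
        have "continuous_on {0..u} f'"
          unfolding continuous_on_eq_continuous_within
        proof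
          fix v assume v: "v \<in> {0..u}"
          then have "(f' has_real_derivative f'' v) (at v within {0..e})"
            using td(1) that te unfolding twice_deriv_on_def by auto
          then have "continuous (at v within {0..e}) f'" by (rule DERIV_continuous)
          then show "continuous (at v within {0..u}) f'"
            by (rule continuous_within_subset) (use that te in auto)
        qed
        moreover have "\<exists>y. (f' has_real_derivative y) (at v) \<and> 0 \<le> y" if v: "0 < v" "v < u" for v
          using twice_deriv_on_interior(2)[OF td(1) sub, of v] td(2) v \<open>u \<le> t\<close> te
          by (intro exI[of _ "f'' v"]) (auto intro: less_imp_le)
        ultimately show ?thesis
          using DERIV_nonneg_imp_increasing_open[of 0 u f'] that by (simp add: m_def)
      qed
      obtain z where z: "0 < z" "z < t" "f t = t * f' z"
        using secant_slope[OF basic_conditions_continuous[OF bc] f0 t(1), of f']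
          twice_deriv_on_interior(1)[OF td(1) sub] te by (metis less_trans)
      have "t * m \<le> f t" using z mono[of z] t by simp
      then have "t * m * m \<le> f t * D"
        using mono[of t] t DD m0 by (intro mult_mono) (auto simp: m_def)
      then have "t * (1 + m\<^sup>2) \<le> x" using D(3) by (simp add: power2_eq_square algebra_simps)
      then have "t \<le> x / (1 + m\<^sup>2)"
        by (subst pos_le_divide_eq) (auto simp: add_pos_nonneg)
      moreover have "0 \<le> f t / D" using t D by simp
      ultimately have up: "crm_abscissa f x t \<le> 1 / (1 + m\<^sup>2) * x" using D(4) by simp
      obtain D' where D': "(f has_real_derivative D') (at t within {0<..\<delta>})" "\<bar>t - f t / D'\<bar> < M / 2 * t\<^sup>2"
        using M t x by force
      have "at t within {0<..\<delta>} = at t"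
        by (rule at_within_open_subset[of _ "{0<..<\<delta>}"]) (use t x in auto)
      then have "D' = D" using D'(1) D(2) DERIV_unique by metis
      then have "\<bar>crm_abscissa f x t\<bar> \<le> M / 2 * t\<^sup>2" using D'(2) D(4) by simp
      also have "\<dots> \<le> M / 2 * x\<^sup>2" using M0 t x by (intro mult_left_mono power_mono) auto
      finally show ?thesis using lo up by blast
    qed
    then show "\<forall>x t. 0 < x \<and> x \<le> eps_of a1 a2 a3 \<and> x \<le> \<delta> \<and> foot f x t \<longrightarrow>
        0 \<le> crm_abscissa f x t \<and> crm_abscissa f x t \<le> 1 / (1 + m\<^sup>2) * x \<and>
        \<bar>crm_abscissa f x t\<bar> \<le> M / 2 * x\<^sup>2"
      by blast
  qed
qed

text \<open>
  The factor lies halfway between \<open>(m - 1) / m\<close>, the rate of Newton's method at a root of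
  multiplicity \<open>m\<close>, and \<open>1\<close>. For \<open>m = 0\<close> division by zero makes it \<open>1/2\<close>.
\<close>

lemma newton_factor_bounds: "0 \<le> 1/2 * ((real m - 1) / real m + 1)" "1/2 * ((real m - 1) / real m + 1) < 1"
  by (cases "m = 0"; simp add: field_simps)+

text \<open>
  On the right of \<open>0\<close> the extension \<open>h\<close> agrees with \<open>f\<close>, so its Newton step is the step of the
  method, and \<open>t < x\<close> carries the factor over from the foot to the iterate.
\<close>

lemma convex_tangential_bounds:
  assumes bc: "basic_conditions f a1 a2 a3" and nonneg: "\<And>u. 0 \<le> f u"
    and c: "case_iv f (eps_of a1 a2 a3) h m" and R: "is_delta_LIN (eps_of a1 a2 a3) h m \<delta>"
    and x: "0 < x" "x \<le> eps_of a1 a2 a3" "x \<le> \<delta>" and ft: "foot f x t"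
  shows "0 \<le> crm_abscissa f x t"
    "crm_abscissa f x t \<le> 1/2 * ((real m - 1) / real m + 1) * x"
proof -
  define e where "e = eps_of a1 a2 a3"
  define k where "k = 1/2 * ((real m - 1) / real m + 1)"
  have k0: "0 \<le> k" unfolding k_def by (rule newton_factor_bounds)
  have f0: "f 0 = 0" using basic_conditions_zero[OF bc] .
  obtain f' f'' where td: "twice_deriv_on f {0<..e} f' f''" "\<forall>t\<in>{0<..e}. 0 < f'' t"
    and hf: "\<forall>t\<in>{0<..e}. h t = f t"
    using c by (auto simp: case_iv_def e_def)
  have "0 \<le> crm_abscissa f x t \<and> crm_abscissa f x t \<le> k * x"
  proof (cases "t = 0")
    case True
    then show ?thesis using f0 k0 x by (simp add: crm_abscissa_def)
  next
    case False
    then obtain D where t: "0 < t" "t < x" "0 < f t" and D: "0 < D" "(f has_real_derivative D) (at t)"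
      "x - t = f t * D" "crm_abscissa f x t = t - f t / D"
      using foot_cases[OF bc nonneg x(1,2) ft] by blast
    have sub: "{0<..<e} \<subseteq> {0<..e}" by auto
    have te: "t < e" using t x e_def by simp
    have DD: "D = f' t" using twice_deriv_on_interior(1)[OF td(1) sub t(1) te] D(2) DERIV_unique by blast
    have "f t \<le> t * D" using convex_le_slope_times[OF bc t(1) te td(1) sub td(2)] DD by simp
    then have lo: "0 \<le> crm_abscissa f x t" unfolding D(4) using D(1) by (simp add: divide_le_eq)
    have "t \<in> {-e..e}" "0 < \<bar>t\<bar>" "\<bar>t\<bar> \<le> \<delta>" using t te x by auto
    then obtain D' where D': "(h has_real_derivative D') (at t within {-e..e})"
      "\<bar>t - h t / D'\<bar> < k * \<bar>t\<bar>"
      using R unfolding is_delta_LIN_def Let_def k_def e_def by blast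
    have "at t within {-e..e} = at t"
      by (rule at_within_open_subset[of _ "{0<..<e}"]) (use t te in auto)
    then have "(h has_real_derivative D') (at t)" using D'(1) by simp
    then have "(f has_real_derivative D') (at t)"
      by (rule has_field_derivative_transform_within_open[of _ _ _ "{0<..<e}"]) (use t te hf in auto)
    then have "D' = D" using D(2) DERIV_unique by blast
    moreover have "h t = f t" using hf t te by auto
    ultimately have "crm_abscissa f x t \<le> k * t" using D'(2) D(4) t by simp
    also have "\<dots> \<le> k * x" using k0 t by (intro mult_left_mono) auto
    finally show ?thesis using lo by blast
  qed
  then show "0 \<le> crm_abscissa f x t"
    "crm_abscissa f x t \<le> 1/2 * ((real m - 1) / real m + 1) * x"
    unfolding k_def by auto
qed


section \<open>Iterating a contraction of the axis\<close>

lemma iterates_contraction: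
  assumes step: "\<And>x. x \<in> S \<Longrightarrow> \<exists>y\<in>S. C_T PA PB (x, 0) = (y, 0) \<and> \<bar>y\<bar> \<le> q * \<bar>x\<bar>"
    and x0: "x0 \<in> S" and q: "0 \<le> q" "q < 1"
  shows "\<exists>x\<in>S. iterates PA PB x0 n = (x, 0)"
    and "never_worse q (iterates PA PB x0)"
    and "iterates PA PB x0 \<longlonglongrightarrow> 0"
proof -
  have S: "\<exists>x\<in>S. iterates PA PB x0 n = (x, 0)" for n
  proof (induction n)
    case 0
    then show ?case using x0 by (auto simp: iterates_def)
  next
    case (Suc n)
    then show ?case using step by (fastforce simp: iterates_def)
  qed
  show "\<exists>x\<in>S. iterates PA PB x0 n = (x, 0)" by (rule S)
  have dec: "norm (iterates PA PB x0 (Suc n)) \<le> q * norm (iterates PA PB x0 n)" for n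
  proof -
    obtain x where x: "x \<in> S" "iterates PA PB x0 n = (x, 0)" using S by blast
    moreover have "iterates PA PB x0 (Suc n) = C_T PA PB (iterates PA PB x0 n)"
      by (simp add: iterates_def)
    ultimately show ?thesis using step[OF x(1)] by (auto simp: norm_Pair)
  qed
  then show "never_worse q (iterates PA PB x0)" by (simp add: never_worse_def)
  have "norm (iterates PA PB x0 n) \<le> q ^ n * norm (iterates PA PB x0 0)" for n
  proof (induction n)
    case (Suc n)
    have "norm (iterates PA PB x0 (Suc n)) \<le> q * (q ^ n * norm (iterates PA PB x0 0))"
      using dec[of n] mult_left_mono[OF Suc q(1)] by linarith
    then show ?case by (simp add: mult.assoc)
  qed simp
  moreover have "(\<lambda>n. q ^ n * norm (iterates PA PB x0 0)) \<longlonglongrightarrow> 0"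
    using q by (intro tendsto_mult_left_zero LIMSEQ_power_zero) auto
  ultimately show "iterates PA PB x0 \<longlonglongrightarrow> 0"
    by (intro Lim_null_comparison[of "iterates PA PB x0"] always_eventually allI)
qed

text \<open>
  A bound on one step near the origin becomes an asymptotic rate once the iterates are known to
  converge.
\<close>

lemma eventually_iterates_bound:
  assumes S: "\<And>n. \<exists>x\<in>S. iterates PA PB x0 n = (x, 0)"
    and lim: "iterates PA PB x0 \<longlonglongrightarrow> 0" and d: "0 < d"
    and bound: "\<And>x. x \<in> S \<Longrightarrow> \<bar>x\<bar> < d \<Longrightarrow> norm (C_T PA PB (x, 0)) \<le> b \<bar>x\<bar>"
  shows "\<forall>\<^sub>F n in sequentially. norm (iterates PA PB x0 (Suc n)) \<le> b (norm (iterates PA PB x0 n))"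
proof -
  have "\<forall>\<^sub>F n in sequentially. norm (iterates PA PB x0 n) < d"
    using order_tendstoD(2)[OF tendsto_norm_zero[OF lim] d] .
  then show ?thesis
  proof eventually_elim
    case (elim n)
    obtain x where x: "x \<in> S" "iterates PA PB x0 n = (x, 0)" using S by blast
    moreover have "iterates PA PB x0 (Suc n) = C_T PA PB (iterates PA PB x0 n)"
      by (simp add: iterates_def)
    ultimately show ?case using bound[of x] elim by (simp add: norm_Pair)
  qed
qed

text \<open>
  Division by zero makes the ratio \<open>0\<close> at a vanishing iterate, so finite convergence needs no
  separate treatment.
\<close>

lemma superlinear_convI:
  assumes "\<And>\<eta>. 0 < \<eta> \<Longrightarrow> \<forall>\<^sub>F n in sequentially. norm (x (Suc n)) \<le> \<eta> * norm (x n)"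
  shows "superlinear_conv x"
  unfolding superlinear_conv_def
proof (rule tendstoI)
  fix e :: real assume e: "0 < e"
  then have "\<forall>\<^sub>F n in sequentially. norm (x (Suc n)) \<le> e / 2 * norm (x n)" using assms[of "e / 2"] by simp
  then show "\<forall>\<^sub>F n in sequentially. dist (norm (x (Suc n)) / norm (x n)) 0 < e"
  proof eventually_elim
    case (elim n)
    show ?case
    proof (cases "norm (x n) = 0")
      case False
      then have "norm (x (Suc n)) / norm (x n) \<le> e / 2" using elim by (simp add: divide_le_eq)
      then have "norm (x (Suc n)) / norm (x n) < e" using e by linarith
      then show ?thesis by (simp add: dist_real_def)
    qed (use e in simp)
  qed
qed

lemma C_T_right:
  assumes bc: "basic_conditions (\<lambda>t. \<bar>\<theta> t\<bar>) a1 a2 a3"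
    and PA: "selector PA (graph_of \<theta>)" and PB: "selector PB axis_B"
    and x: "0 \<le> x" "x \<le> eps_of a1 a2 a3"
  obtains (zero) "x = 0" "C_T PA PB (x, 0) = (0, 0)"
  | (pos) t where "0 < x" "foot (\<lambda>t. \<bar>\<theta> t\<bar>) x t"
      "C_T PA PB (x, 0) = (crm_abscissa (\<lambda>t. \<bar>\<theta> t\<bar>) x t, 0)"
proof -
  let ?f = "\<lambda>t. \<bar>\<theta> t\<bar>"
  have f0: "\<theta> 0 = 0" using basic_conditions_zero[OF bc] by simp
  have "\<exists>t. foot \<theta> x t"
    using foot_exists[OF basic_conditions_continuous[OF bc]] f0 foot_abs[of \<theta>] by simp
  then obtain t where t: "PA (x, 0) = (t, \<theta> t)" "foot \<theta> x t"
    using selector_axis_foot[OF PA] by blast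
  show thesis
  proof (cases "x = 0")
    case True
    have "t\<^sup>2 + (\<theta> t)\<^sup>2 \<le> 0" using t(2)[unfolded foot_def, rule_format, of 0] True f0 by simp
    then have "t = 0" by (simp add: sum_power2_le_zero_iff)
    then have "C_T PA PB (x, 0) = (crm_abscissa \<theta> x t, 0)"
      using f0 by (intro C_T_axis[where \<theta> = \<theta> and PA = PA, OF PB t(1)]) simp
    then have "C_T PA PB (x, 0) = (0, 0)"
      using \<open>t = 0\<close> f0 by (simp add: crm_abscissa_def)
    with True show thesis by (rule zero)
  next
    case False
    have fa: "foot ?f x t" using t(2) foot_abs by blast
    have "t \<noteq> x" using foot_less[OF bc _ _ x(2) fa] False x by auto
    then have "C_T PA PB (x, 0) = (crm_abscissa ?f x t, 0)"
      using C_T_axis[where \<theta> = \<theta> and PA = PA, OF PB t(1)] by (simp add: crm_abscissa_abs)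
    moreover have "0 < x" using False x(1) by simp
    ultimately show thesis using pos fa by blast
  qed
qed

lemma C_T_left:
  assumes bc: "basic_conditions (\<lambda>t. \<bar>\<theta> t\<bar>) a1 a2 a3"
    and bc': "basic_conditions (\<lambda>t. \<bar>\<theta> (- t)\<bar>) b1 b2 b3"
    and PA: "selector PA (graph_of \<theta>)" and PB: "selector PB axis_B"
    and x: "x < 0" "- x \<le> eps_of b1 b2 b3"
  obtains t where "foot (\<lambda>t. \<bar>\<theta> (- t)\<bar>) (- x) t"
      "C_T PA PB (x, 0) = (- crm_abscissa (\<lambda>t. \<bar>\<theta> (- t)\<bar>) (- x) t, 0)"
proof -
  let ?g = "\<lambda>t. \<bar>\<theta> (- t)\<bar>"
  have f0: "\<theta> 0 = 0" using basic_conditions_zero[OF bc] by simp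
  have "\<exists>t. foot \<theta> x t"
    using foot_exists[OF basic_conditions_continuous[OF bc]] f0 foot_abs[of \<theta>] by simp
  then obtain t where t: "PA (x, 0) = (t, \<theta> t)" "foot \<theta> x t"
    using selector_axis_foot[OF PA] by blast
  have fa: "foot ?g (- x) (- t)" using t(2) foot_reflect by blast
  have "t \<noteq> x" using foot_less[OF bc' _ _ x(2) fa] x by auto
  then have "C_T PA PB (x, 0) = (- crm_abscissa ?g (- x) (- t), 0)"
    using C_T_axis[where \<theta> = \<theta> and PA = PA, OF PB t(1)] by (simp add: crm_abscissa_reflect)
  with fa show thesis by (rule that)
qed

text \<open>
  An iterate may change sides, so rates need a bound on both: on the left the step is that of the
  graph reflected in the vertical axis.
\<close>

lemma C_T_two_sided:
  assumes bc: "basic_conditions (\<lambda>t. \<bar>\<theta> t\<bar>) a1 a2 a3"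
    and bc': "basic_conditions (\<lambda>t. \<bar>\<theta> (- t)\<bar>) b1 b2 b3"
    and PA: "selector PA (graph_of \<theta>)" and PB: "selector PB axis_B"
    and x: "\<bar>x\<bar> \<le> eps_of a1 a2 a3" "\<bar>x\<bar> \<le> eps_of b1 b2 b3"
    and b0: "0 \<le> b 0"
    and right: "\<And>t. 0 < x \<Longrightarrow> foot (\<lambda>t. \<bar>\<theta> t\<bar>) x t \<Longrightarrow> \<bar>crm_abscissa (\<lambda>t. \<bar>\<theta> t\<bar>) x t\<bar> \<le> b x"
    and left: "\<And>t. x < 0 \<Longrightarrow> foot (\<lambda>t. \<bar>\<theta> (- t)\<bar>) (- x) t \<Longrightarrow>
      \<bar>crm_abscissa (\<lambda>t. \<bar>\<theta> (- t)\<bar>) (- x) t\<bar> \<le> b (- x)"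
  shows "\<exists>y. C_T PA PB (x, 0) = (y, 0) \<and> \<bar>y\<bar> \<le> b \<bar>x\<bar>"
proof (cases "0 \<le> x")
  case True
  then have xe: "x \<le> eps_of a1 a2 a3" using x by simp
  show ?thesis
    by (rule C_T_right[OF bc PA PB True xe]) (use b0 right in auto)
next
  case False
  then have x0: "x < 0" and xe: "- x \<le> eps_of b1 b2 b3" using x by simp_all
  show ?thesis
    by (rule C_T_left[OF bc bc' PA PB x0 xe]) (use x0 left in auto)
qed

text \<open>
  With the factor \<open>1 / K < 1\<close> on both sides the symmetric interval of radius \<open>r\<close> is mapped into itself,
  whatever side the next iterate falls on.
\<close>

lemma two_sided_linear_convergence:
  assumes bc: "basic_conditions (\<lambda>t. \<bar>\<theta> t\<bar>) a1 a2 a3"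
    and bc': "basic_conditions (\<lambda>t. \<bar>\<theta> (- t)\<bar>) b1 b2 b3"
    and PA: "selector PA (graph_of \<theta>)" and PB: "selector PB axis_B"
    and K: "1 < K" "is_eps_K K (\<lambda>t. \<bar>\<theta> t\<bar>) ef" "is_eps_K K (\<lambda>t. \<bar>\<theta> (- t)\<bar>) eg"
    and r: "r \<le> eps_of a1 a2 a3" "r \<le> eps_of b1 b2 b3" "r \<le> ef" "r \<le> eg"
    and x0: "\<bar>x0\<bar> \<le> r"
  shows "\<exists>x\<in>{-r..r}. iterates PA PB x0 n = (x, 0)"
    and "never_worse (1 / K) (iterates PA PB x0)"
    and "iterates PA PB x0 \<longlonglongrightarrow> 0"
proof -
  have step: "\<exists>y\<in>{-r..r}. C_T PA PB (x, 0) = (y, 0) \<and> \<bar>y\<bar> \<le> 1 / K * \<bar>x\<bar>" if "x \<in> {-r..r}" for x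
  proof -
    have xr: "\<bar>x\<bar> \<le> r" using that by auto
    have "\<exists>y. C_T PA PB (x, 0) = (y, 0) \<and> \<bar>y\<bar> \<le> 1 / K * \<bar>x\<bar>"
    proof (rule C_T_two_sided[OF bc bc' PA PB])
      fix t assume a: "0 < x" "foot (\<lambda>t. \<bar>\<theta> t\<bar>) x t"
      have x': "x \<le> eps_of a1 a2 a3" "x \<le> ef" using a(1) xr r by linarith+
      have "t \<noteq> x" using foot_less[OF bc _ a(1) x'(1) a(2)] by auto
      then show "\<bar>crm_abscissa (\<lambda>t. \<bar>\<theta> t\<bar>) x t\<bar> \<le> 1 / K * x"
        using is_eps_K_bound[OF K(2) a(1) x'(2) a(2) _ PB] by blast
    next
      fix t assume a: "x < 0" "foot (\<lambda>t. \<bar>\<theta> (- t)\<bar>) (- x) t"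
      then have x': "0 < - x" "- x \<le> eps_of b1 b2 b3" "- x \<le> eg" using xr r by linarith+
      have "t \<noteq> - x" using foot_less[OF bc' _ x'(1,2) a(2)] by auto
      then show "\<bar>crm_abscissa (\<lambda>t. \<bar>\<theta> (- t)\<bar>) (- x) t\<bar> \<le> 1 / K * - x"
        using is_eps_K_bound[OF K(3) x'(1,3) a(2) _ PB] by blast
    qed (use xr r in auto)
    then obtain y where y: "C_T PA PB (x, 0) = (y, 0)" "\<bar>y\<bar> \<le> 1 / K * \<bar>x\<bar>" by blast
    have "1 / K * \<bar>x\<bar> \<le> \<bar>x\<bar>" using K(1) by (simp add: divide_le_eq mult_le_cancel_left1)
    then have "\<bar>y\<bar> \<le> r" using y(2) xr by linarith
    then show ?thesis using y by (intro bexI[of _ y]) auto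
  qed
  note ic = iterates_contraction[of "{-r..r}" PA PB "1 / K" x0, OF step]
  have q: "x0 \<in> {-r..r}" "0 \<le> 1 / K" "1 / K < 1" using x0 K(1) by auto
  show "\<exists>x\<in>{-r..r}. iterates PA PB x0 n = (x, 0)"
    "never_worse (1 / K) (iterates PA PB x0)" "iterates PA PB x0 \<longlonglongrightarrow> 0"
    using ic(1)[OF _ q] ic(2)[OF _ q] ic(3)[OF _ q] by blast+
qed

text \<open>
  A step that stays on the right of \<open>0\<close> maps \<open>[0, r]\<close> into itself, so estimates for \<open>\<bar>\<theta>\<bar>\<close> on the right
  half-line suffice.
\<close>

lemma one_sided_linear_convergence:
  assumes bc: "basic_conditions (\<lambda>t. \<bar>\<theta> t\<bar>) a1 a2 a3"
    and PA: "selector PA (graph_of \<theta>)" and PB: "selector PB axis_B"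
    and r: "r \<le> eps_of a1 a2 a3" and x0: "0 \<le> x0" "x0 \<le> r" and q: "0 \<le> q" "q < 1"
    and bd: "\<And>x t. \<lbrakk>0 < x; x \<le> r; foot (\<lambda>t. \<bar>\<theta> t\<bar>) x t\<rbrakk> \<Longrightarrow>
      0 \<le> crm_abscissa (\<lambda>t. \<bar>\<theta> t\<bar>) x t \<and> crm_abscissa (\<lambda>t. \<bar>\<theta> t\<bar>) x t \<le> q * x"
  shows "\<exists>x\<in>{0..r}. iterates PA PB x0 n = (x, 0)"
    and "never_worse q (iterates PA PB x0)"
    and "iterates PA PB x0 \<longlonglongrightarrow> 0"
proof -
  have step: "\<exists>y\<in>{0..r}. C_T PA PB (x, 0) = (y, 0) \<and> \<bar>y\<bar> \<le> q * \<bar>x\<bar>" if x: "x \<in> {0..r}" for x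
  proof -
    have x': "0 \<le> x" "x \<le> eps_of a1 a2 a3" using x r by auto
    have qx: "q * x \<le> r" using mult_left_le_one_le[of x q] q x'(1) x by simp
    show ?thesis
    proof (rule C_T_right[OF bc PA PB x'])
      assume "x = 0" "C_T PA PB (x, 0) = (0, 0)"
      then show ?thesis using x by auto
    next
      fix t assume t: "0 < x" "foot (\<lambda>t. \<bar>\<theta> t\<bar>) x t"
        "C_T PA PB (x, 0) = (crm_abscissa (\<lambda>t. \<bar>\<theta> t\<bar>) x t, 0)"
      then show ?thesis
        using bd[of x t] x qx
        by (intro bexI[of _ "crm_abscissa (\<lambda>t. \<bar>\<theta> t\<bar>) x t"]) auto
    qed
  qed
  note ic = iterates_contraction[of "{0..r}" PA PB q x0, OF step]
  have q': "x0 \<in> {0..r}" using x0 by auto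
  show "\<exists>x\<in>{0..r}. iterates PA PB x0 n = (x, 0)"
    "never_worse q (iterates PA PB x0)" "iterates PA PB x0 \<longlonglongrightarrow> 0"
    using ic(1)[OF _ q' q] ic(2)[OF _ q' q] ic(3)[OF _ q' q] by blast+
qed


section \<open>The convergence theorem\<close>

theorem theorem5p6:
  fixes \<theta> :: "real \<Rightarrow> real"
    and PA PB :: "real \<times> real \<Rightarrow> real \<times> real"
    and a1 a2 a3 b1 b2 b3 :: real
  defines "f \<equiv> (\<lambda>t. \<bar>\<theta> t\<bar>)" and "g \<equiv> (\<lambda>t. \<bar>\<theta> (- t)\<bar>)"
    and "\<epsilon>f \<equiv> eps_of a1 a2 a3" and "\<epsilon>g \<equiv> eps_of b1 b2 b3"
  assumes "basic_conditions f a1 a2 a3"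
    and "basic_conditions g b1 b2 b3"
    and "selector PA (graph_of \<theta>)"
    and "selector PB axis_B"
  shows
    "(\<forall>K' \<epsilon>Kf \<epsilon>Kg x0.
        case_i f \<epsilon>f \<and> case_i g \<epsilon>g \<and> K' > 1 \<and> is_eps_K K' f \<epsilon>Kf \<and> is_eps_K K' g \<epsilon>Kg \<and>
        \<bar>x0\<bar> \<le> Min {\<epsilon>f, \<epsilon>g, \<epsilon>Kf, \<epsilon>Kg} \<longrightarrow>
        iterates PA PB x0 \<longlonglongrightarrow> 0 \<and> never_worse (1 / K') (iterates PA PB x0) \<and>
        (finite_conv (iterates PA PB x0) \<or> quadratic_conv (iterates PA PB x0))) \<and>
     (\<forall>K' \<epsilon>Kf \<epsilon>Kg x0.
        case_ii f \<epsilon>f \<and> case_ii g \<epsilon>g \<and> K' > 1 \<and> is_eps_K K' f \<epsilon>Kf \<and> is_eps_K K' g \<epsilon>Kg \<and>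
        \<bar>x0\<bar> \<le> Min {\<epsilon>f, \<epsilon>g, \<epsilon>Kf, \<epsilon>Kg} \<longrightarrow>
        iterates PA PB x0 \<longlonglongrightarrow> 0 \<and> never_worse (1 / K') (iterates PA PB x0) \<and>
        (finite_conv (iterates PA PB x0) \<or> superlinear_conv (iterates PA PB x0))) \<and>
     (\<forall>\<delta> x0.
        case_iii f \<epsilon>f \<and> is_delta_RIGHT f \<delta> \<and> x0 \<in> {0..min \<epsilon>f \<delta>} \<longrightarrow>
        iterates PA PB x0 \<longlonglongrightarrow> 0 \<and>
        (finite_conv (iterates PA PB x0) \<or> quadratic_conv (iterates PA PB x0))) \<and>
     (\<forall>h m \<delta> x0.
        case_iv f \<epsilon>f h m \<and> is_delta_LIN \<epsilon>f h m \<delta> \<and> x0 \<in> {0..min \<epsilon>f \<delta>} \<longrightarrow>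
        iterates PA PB x0 \<longlonglongrightarrow> 0 \<and>
        (finite_conv (iterates PA PB x0) \<or> linear_conv (iterates PA PB x0)))"
proof (intro conjI allI impI)
  have nonneg: "\<And>u. 0 \<le> f u" "\<And>u. 0 \<le> g u" by (simp_all add: f_def g_def)
  note fg = assms(5-8)
  note bc = fg(1)[unfolded f_def] and bc' = fg(2)[unfolded g_def] and PA = fg(3) and PB = fg(4)
  {
    fix K' \<epsilon>Kf \<epsilon>Kg x0
    assume H: "case_i f \<epsilon>f \<and> case_i g \<epsilon>g \<and> K' > 1 \<and> is_eps_K K' f \<epsilon>Kf \<and> is_eps_K K' g \<epsilon>Kg \<and>
      \<bar>x0\<bar> \<le> Min {\<epsilon>f, \<epsilon>g, \<epsilon>Kf, \<epsilon>Kg}"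
    define r where "r = Min {\<epsilon>f, \<epsilon>g, \<epsilon>Kf, \<epsilon>Kg}"
    have r: "r \<le> eps_of a1 a2 a3" "r \<le> eps_of b1 b2 b3" "r \<le> \<epsilon>Kf" "r \<le> \<epsilon>Kg" "\<bar>x0\<bar> \<le> r"
      using H by (auto simp: r_def \<epsilon>f_def \<epsilon>g_def)
    note conv = two_sided_linear_convergence[OF bc bc' PA PB _ _ _ r]
    have conv: "\<And>n. \<exists>x\<in>{-r..r}. iterates PA PB x0 n = (x, 0)"
      "never_worse (1 / K') (iterates PA PB x0)" "iterates PA PB x0 \<longlonglongrightarrow> 0"
      using conv[of K'] H unfolding f_def g_def by blast+
    show "iterates PA PB x0 \<longlonglongrightarrow> 0" "never_worse (1 / K') (iterates PA PB x0)"
      using conv by blast+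
    have ci: "case_i f (eps_of a1 a2 a3)" "case_i g (eps_of b1 b2 b3)"
      using H by (simp_all add: \<epsilon>f_def \<epsilon>g_def)
    obtain d M where M: "0 < d" "\<And>x t. \<lbrakk>0 < x; x \<le> eps_of a1 a2 a3; x < d; foot f x t\<rbrakk> \<Longrightarrow>
        \<bar>crm_abscissa f x t\<bar> \<le> M * x\<^sup>2"
      using concave_quadratic_bound[OF fg(1) nonneg(1) ci(1)] by blast
    obtain d' N where N: "0 < d'" "\<And>x t. \<lbrakk>0 < x; x \<le> eps_of b1 b2 b3; x < d'; foot g x t\<rbrakk> \<Longrightarrow>
        \<bar>crm_abscissa g x t\<bar> \<le> N * x\<^sup>2"
      using concave_quadratic_bound[OF fg(2) nonneg(2) ci(2)] by blast
    define Q where "Q = max M N"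
    have "\<forall>\<^sub>F n in sequentially. norm (iterates PA PB x0 (Suc n)) \<le> Q * (norm (iterates PA PB x0 n))\<^sup>2"
    proof (rule eventually_iterates_bound[OF conv(1,3), where d = "min d d'"])
      fix x assume x: "x \<in> {-r..r}" "\<bar>x\<bar> < min d d'"
      have xr: "\<bar>x\<bar> \<le> eps_of a1 a2 a3" "\<bar>x\<bar> \<le> eps_of b1 b2 b3" using x r by auto
      have QM: "M * y\<^sup>2 \<le> Q * y\<^sup>2" "N * y\<^sup>2 \<le> Q * y\<^sup>2" for y by (simp_all add: Q_def mult_right_mono)
      have "\<exists>y. C_T PA PB (x, 0) = (y, 0) \<and> \<bar>y\<bar> \<le> Q * \<bar>x\<bar>\<^sup>2"
      proof (rule C_T_two_sided[OF bc bc' PA PB xr, where b = "\<lambda>y. Q * y\<^sup>2"])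
        show "\<bar>crm_abscissa (\<lambda>t. \<bar>\<theta> t\<bar>) x t\<bar> \<le> Q * x\<^sup>2" if "0 < x" "foot (\<lambda>t. \<bar>\<theta> t\<bar>) x t" for t
          using order_trans[OF M(2)[unfolded f_def, of x t] QM(1)[of x]] that xr x by simp
        show "\<bar>crm_abscissa (\<lambda>t. \<bar>\<theta> (- t)\<bar>) (- x) t\<bar> \<le> Q * (- x)\<^sup>2"
          if "x < 0" "foot (\<lambda>t. \<bar>\<theta> (- t)\<bar>) (- x) t" for t
          using order_trans[OF N(2)[unfolded g_def, of "- x" t] QM(2)[of "- x"]] that xr x by simp
      qed simp
      then show "norm (C_T PA PB (x, 0)) \<le> Q * \<bar>x\<bar>\<^sup>2" by (auto simp: norm_Pair)
    qed (use M N in auto)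
    then have "quadratic_conv (iterates PA PB x0)" unfolding quadratic_conv_def by blast
    then show "finite_conv (iterates PA PB x0) \<or> quadratic_conv (iterates PA PB x0)" ..
  }
  {
    fix K' \<epsilon>Kf \<epsilon>Kg x0
    assume H: "case_ii f \<epsilon>f \<and> case_ii g \<epsilon>g \<and> K' > 1 \<and> is_eps_K K' f \<epsilon>Kf \<and> is_eps_K K' g \<epsilon>Kg \<and>
      \<bar>x0\<bar> \<le> Min {\<epsilon>f, \<epsilon>g, \<epsilon>Kf, \<epsilon>Kg}"
    define r where "r = Min {\<epsilon>f, \<epsilon>g, \<epsilon>Kf, \<epsilon>Kg}"
    have r: "r \<le> eps_of a1 a2 a3" "r \<le> eps_of b1 b2 b3" "r \<le> \<epsilon>Kf" "r \<le> \<epsilon>Kg" "\<bar>x0\<bar> \<le> r"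
      using H by (auto simp: r_def \<epsilon>f_def \<epsilon>g_def)
    note conv = two_sided_linear_convergence[OF bc bc' PA PB _ _ _ r]
    have conv: "\<And>n. \<exists>x\<in>{-r..r}. iterates PA PB x0 n = (x, 0)"
      "never_worse (1 / K') (iterates PA PB x0)" "iterates PA PB x0 \<longlonglongrightarrow> 0"
      using conv[of K'] H unfolding f_def g_def by blast+
    show "iterates PA PB x0 \<longlonglongrightarrow> 0" "never_worse (1 / K') (iterates PA PB x0)"
      using conv by blast+
    have cii: "case_ii f (eps_of a1 a2 a3)" "case_ii g (eps_of b1 b2 b3)"
      using H by (simp_all add: \<epsilon>f_def \<epsilon>g_def)
    have "superlinear_conv (iterates PA PB x0)"
    proof (rule superlinear_convI)
      fix \<eta> :: real assume eta: "0 < \<eta>"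
      obtain d where M: "0 < d" "\<And>x t. \<lbrakk>0 < x; x \<le> eps_of a1 a2 a3; x < d; foot f x t\<rbrakk> \<Longrightarrow>
          \<bar>crm_abscissa f x t\<bar> \<le> \<eta> * x"
        using vertical_superlinear_bound[OF fg(1) nonneg(1) cii(1) eta] by blast
      obtain d' where N: "0 < d'" "\<And>x t. \<lbrakk>0 < x; x \<le> eps_of b1 b2 b3; x < d'; foot g x t\<rbrakk> \<Longrightarrow>
          \<bar>crm_abscissa g x t\<bar> \<le> \<eta> * x"
        using vertical_superlinear_bound[OF fg(2) nonneg(2) cii(2) eta] by blast
      show "\<forall>\<^sub>F n in sequentially. norm (iterates PA PB x0 (Suc n)) \<le> \<eta> * norm (iterates PA PB x0 n)"
      proof (rule eventually_iterates_bound[OF conv(1,3), where d = "min d d'"])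
        fix x assume x: "x \<in> {-r..r}" "\<bar>x\<bar> < min d d'"
        have xr: "\<bar>x\<bar> \<le> eps_of a1 a2 a3" "\<bar>x\<bar> \<le> eps_of b1 b2 b3" using x r by auto
        have "\<exists>y. C_T PA PB (x, 0) = (y, 0) \<and> \<bar>y\<bar> \<le> \<eta> * \<bar>x\<bar>"
        proof (rule C_T_two_sided[OF bc bc' PA PB xr])
          show "\<bar>crm_abscissa (\<lambda>t. \<bar>\<theta> t\<bar>) x t\<bar> \<le> \<eta> * x" if "0 < x" "foot (\<lambda>t. \<bar>\<theta> t\<bar>) x t" for t
            using M(2)[unfolded f_def, of x t] that xr x by auto
          show "\<bar>crm_abscissa (\<lambda>t. \<bar>\<theta> (- t)\<bar>) (- x) t\<bar> \<le> \<eta> * - x"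
            if "x < 0" "foot (\<lambda>t. \<bar>\<theta> (- t)\<bar>) (- x) t" for t
            using N(2)[unfolded g_def, of "- x" t] that xr x by auto
        qed simp
        then show "norm (C_T PA PB (x, 0)) \<le> \<eta> * \<bar>x\<bar>" by (auto simp: norm_Pair)
      qed (use M N in auto)
    qed
    then show "finite_conv (iterates PA PB x0) \<or> superlinear_conv (iterates PA PB x0)" ..
  }
  {
    fix \<delta> x0
    assume H: "case_iii f \<epsilon>f \<and> is_delta_RIGHT f \<delta> \<and> x0 \<in> {0..min \<epsilon>f \<delta>}"
    have ciii: "case_iii f (eps_of a1 a2 a3)" "is_delta_RIGHT f \<delta>"
      using H by (simp_all add: \<epsilon>f_def)
    obtain q M where q: "0 \<le> q" "q < 1"
      and bd: "\<And>x t. \<lbrakk>0 < x; x \<le> eps_of a1 a2 a3; x \<le> \<delta>; foot f x t\<rbrakk> \<Longrightarrow>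
        0 \<le> crm_abscissa f x t \<and> crm_abscissa f x t \<le> q * x \<and> \<bar>crm_abscissa f x t\<bar> \<le> M * x\<^sup>2"
      using convex_transversal_bounds[OF fg(1) nonneg(1) ciii] by blast
    define r where "r = min \<epsilon>f \<delta>"
    have r: "r \<le> eps_of a1 a2 a3" "0 \<le> x0" "x0 \<le> r" using H by (auto simp: r_def \<epsilon>f_def)
    have bd': "0 \<le> crm_abscissa (\<lambda>t. \<bar>\<theta> t\<bar>) x t \<and> crm_abscissa (\<lambda>t. \<bar>\<theta> t\<bar>) x t \<le> q * x"
      if "0 < x" "x \<le> r" "foot (\<lambda>t. \<bar>\<theta> t\<bar>) x t" for x t
      using bd[of x t] that unfolding f_def r_def \<epsilon>f_def by auto
    note conv = one_sided_linear_convergence[OF bc PA PB r q bd']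
    show lim: "iterates PA PB x0 \<longlonglongrightarrow> 0" using conv(3) by blast
    have S: "\<And>n. \<exists>x\<in>{0..r}. iterates PA PB x0 n = (x, 0)" using conv(1) by blast
    have "\<forall>\<^sub>F n in sequentially. norm (iterates PA PB x0 (Suc n)) \<le> M * (norm (iterates PA PB x0 n))\<^sup>2"
    proof (rule eventually_iterates_bound[OF S lim zero_less_one])
      fix x assume "x \<in> {0..r}"
      then have x: "0 \<le> x" "x \<le> eps_of a1 a2 a3" "x \<le> \<delta>" by (auto simp: r_def \<epsilon>f_def)
      show "norm (C_T PA PB (x, 0)) \<le> M * \<bar>x\<bar>\<^sup>2"
      proof (rule C_T_right[OF bc PA PB x(1,2)])
        fix t assume "0 < x" "foot (\<lambda>t. \<bar>\<theta> t\<bar>) x t"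
          and CT: "C_T PA PB (x, 0) = (crm_abscissa (\<lambda>t. \<bar>\<theta> t\<bar>) x t, 0)"
        then have "\<bar>crm_abscissa (\<lambda>t. \<bar>\<theta> t\<bar>) x t\<bar> \<le> M * x\<^sup>2"
          using bd[unfolded f_def, OF _ x(2,3)] by blast
        then show ?thesis using CT by (simp add: norm_Pair)
      qed simp
    qed
    then have "quadratic_conv (iterates PA PB x0)" unfolding quadratic_conv_def by blast
    then show "finite_conv (iterates PA PB x0) \<or> quadratic_conv (iterates PA PB x0)" ..
  }
  {
    fix h m \<delta> x0
    assume H: "case_iv f \<epsilon>f h m \<and> is_delta_LIN \<epsilon>f h m \<delta> \<and> x0 \<in> {0..min \<epsilon>f \<delta>}"
    define r where "r = min \<epsilon>f \<delta>"
    have r: "r \<le> eps_of a1 a2 a3" "0 \<le> x0" "x0 \<le> r" using H by (auto simp: r_def \<epsilon>f_def)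
    have bd: "0 \<le> crm_abscissa (\<lambda>t. \<bar>\<theta> t\<bar>) x t \<and>
        crm_abscissa (\<lambda>t. \<bar>\<theta> t\<bar>) x t \<le> 1/2 * ((real m - 1) / real m + 1) * x"
      if "0 < x" "x \<le> r" "foot (\<lambda>t. \<bar>\<theta> t\<bar>) x t" for x t
      using convex_tangential_bounds[OF fg(1) nonneg(1), of h m \<delta> x t] that H
      unfolding f_def r_def \<epsilon>f_def by auto
    note conv = one_sided_linear_convergence[OF bc PA PB r newton_factor_bounds bd]
    show "iterates PA PB x0 \<longlonglongrightarrow> 0" using conv(3) by blast
    have "never_worse (1/2 * ((real m - 1) / real m + 1)) (iterates PA PB x0)"
      using conv(2) by blast
    then have "linear_conv (iterates PA PB x0)"
      unfolding linear_conv_def never_worse_def using newton_factor_bounds(2) always_eventually by blast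
    then show "finite_conv (iterates PA PB x0) \<or> linear_conv (iterates PA PB x0)" ..
  }
qed

end
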